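(* Let $B$ be a separable Banach space with norm $|\cdot|$, let $(\Omega,\mathcal{F},P)$ be a probability space, and let $(\mathcal{F}^k)_{k\ge1}$ be a decreasing sequence of sub-sigma-fields of $\mathcal{F}$. Let $(a_j)_{j\ge1}$ be real constants with $\sum_{j\ge1}|a_j|=\infty$, and let $s_k=\sum_{i=1}^ka_i$. Let $X$ be a $B$-valued random variable. (i) For every $p>1$ there is a constant $C$ depending only on $p$ such that, if $E|X|^p<\infty$, then for all $n\ge1$ $$E\max_{1\le k\le n}\Big|\sum_{j=1}^ka_jE^jX\Big|^p\le C\Big(E\max_{1\le k\le n}|s_kE^kX|^p+E\Big|\sum_{j=1}^na_jE^jX\Big|^p\Big).$$ (ii) If $1\le p\le2$ and $B$ is $p$-smooth, there is a constant $C$ depending only on $p$ and $B$ such that, if $E|X|^p<\infty$, then for all $n\ge1$ $$E\max_{1\le k\le n}\Big|\sum_{j=1}^ka_jE^jX\Big|^p\le C\Big(E\max_{1\le k\le n}|s_kE^kX|^p+\sum_{i=1}^{n-1}E|s_iP^i(X)|^p\Big).$$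
   Context: For an integrable $B$-valued random variable $Y$, $E^jY=E(Y\mid\mathcal{F}^j)$ and $P^i(Y)=E^iY-E^{i+1}Y$. A Banach space $B$ is called $r$-smooth ($1\le r\le2$) if it has an equivalent norm whose modulus of smoothness $\rho(\tau)=\sup\{\tfrac12(|x+\tau y|+|x-\tau y|)-1:\ |x|=|y|=1\}$ satisfies $\rho(\tau)\le K\tau^r$ for some constant $K$ and all $\tau>0$ (for $r=1$ this is no restriction). A known consequence (Assouad, 1975): if $B$ is separable and $r$-smooth there is $D>0$ such that $E|Y_1+\dots+Y_n|^r\le D\sum_{i=1}^nE|Y_i|^r$ for every $n$ and all $B$-valued martingale differences $Y_1,\dots,Y_n$. *)

theory Defs
  imports "HOL-Probability.Probability"
begin

text \<open>
  Separable Banach spaces are types of class \<open>banach\<close> and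
  \<open>second_countable_topology\<close>; for a metric space, second countable and separable coincide.
\<close>

section \<open>Conditional expectation of Banach-valued random variables\<close>

definition is_cond_expect ::
  "'a measure \<Rightarrow> 'a measure \<Rightarrow> ('a \<Rightarrow> 'b::{banach, second_countable_topology}) \<Rightarrow> ('a \<Rightarrow> 'b) \<Rightarrow> bool"
  where
  "is_cond_expect M G Y Z \<longleftrightarrow>
     Z \<in> borel_measurable G \<and> integrable M Z \<and>
     (\<forall>A\<in>sets G. (LINT \<omega>:A|M. Z \<omega>) = (LINT \<omega>:A|M. Y \<omega>))"

text \<open>
  \<open>E(Y | G)\<close>: a version is picked by choice, as versions are unique only almost everywhere.
  Meaningful for integrable \<open>Y\<close> and a sub-sigma-field \<open>G\<close> of a probability space \<open>M\<close>.
\<close>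
definition cond_expect ::
  "'a measure \<Rightarrow> 'a measure \<Rightarrow> ('a \<Rightarrow> 'b::{banach, second_countable_topology}) \<Rightarrow> 'a \<Rightarrow> 'b"
  where
  "cond_expect M G Y = (SOME Z. is_cond_expect M G Y Z)"

definition proj_diff ::
  "'a measure \<Rightarrow> (nat \<Rightarrow> 'a measure) \<Rightarrow> nat \<Rightarrow> ('a \<Rightarrow> 'b::{banach, second_countable_topology}) \<Rightarrow> 'a \<Rightarrow> 'b"
  where
  "proj_diff M F i Y \<omega> = cond_expect M (F i) Y \<omega> - cond_expect M (F (Suc i)) Y \<omega>"

text \<open>The sequence is indexed from 1; \<open>F 0\<close> is unconstrained.\<close>
definition decreasing_subfields :: "'a measure \<Rightarrow> (nat \<Rightarrow> 'a measure) \<Rightarrow> bool" where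
  "decreasing_subfields M F \<longleftrightarrow>
     (\<forall>k\<ge>1. subalgebra M (F k)) \<and> (\<forall>k\<ge>1. sets (F (Suc k)) \<subseteq> sets (F k))"

section \<open>Smooth Banach spaces\<close>

text \<open>Definiteness and nonnegativity of \<open>N\<close> follow from the lower bound by \<open>norm\<close>.\<close>
definition equivalent_norm :: "('b::real_normed_vector \<Rightarrow> real) \<Rightarrow> bool" where
  "equivalent_norm N \<longleftrightarrow>
     (\<forall>x y. N (x + y) \<le> N x + N y) \<and>
     (\<forall>c x. N (c *\<^sub>R x) = \<bar>c\<bar> * N x) \<and>
     (\<exists>c>0. \<exists>C. \<forall>x. c * norm x \<le> N x \<and> N x \<le> C * norm x)"

text \<open>
  The supremum is taken in the extended reals, so that it is also meaningful (namely
  minus infinity) for the zero space, where no unit vectors exist.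
\<close>
definition modulus_of_smoothness :: "('b::real_normed_vector \<Rightarrow> real) \<Rightarrow> real \<Rightarrow> ereal" where
  "modulus_of_smoothness N \<tau> =
     Sup {ereal ((N (x + \<tau> *\<^sub>R y) + N (x - \<tau> *\<^sub>R y)) / 2 - 1) | x y. N x = 1 \<and> N y = 1}"

definition r_smooth :: "'b::real_normed_vector itself \<Rightarrow> real \<Rightarrow> bool" where
  "r_smooth _ r \<longleftrightarrow>
     (\<exists>N :: 'b \<Rightarrow> real. equivalent_norm N \<and>
        (\<exists>K::real. \<forall>\<tau>>0. modulus_of_smoothness N \<tau> \<le> ereal (K * \<tau> powr r)))"

section \<open>The constants\<close>

text \<open>
  An existentially quantified real inside a polymorphic theorem may depend on all type variables
  of the theorem, hence on the Banach space and on the sample space. The constants are therefore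
  named, and their types record what they depend on: \<open>real \<Rightarrow> real\<close> for a constant
  depending only on the exponent, \<open>'b itself \<Rightarrow> real \<Rightarrow> real\<close> for one depending only on the
  exponent and the Banach space. No optimality is intended.

  The first one comes from writing the partial sum \<open>S k\<close> as
  \<open>s k E(X | F k) + S n - E(S n | F k)\<close> and applying Doob's inequality to the last term.
\<close>
definition max_const :: "real \<Rightarrow> real" where
  "max_const p = (3 * p / (p - 1)) powr p"

text \<open>
  A number controlling both the equivalence of norms and the modulus of smoothness. Rescaling an
  equivalent norm does not change its modulus, so such a number exists iff the space is
  \<open>r\<close>-smooth.
\<close>
definition smoothness_const :: "'b::real_normed_vector itself \<Rightarrow> real \<Rightarrow> real" where
  "smoothness_const _ r =
     (SOME K. 1 \<le> K \<and> (\<exists>N :: 'b \<Rightarrow> real. equivalent_norm N \<and>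
        (\<forall>x. norm x \<le> N x \<and> N x \<le> K * norm x) \<and>
        (\<forall>\<tau>>0. modulus_of_smoothness N \<tau> \<le> ereal (K * \<tau> powr r))))"

text \<open>
  With \<open>K\<close> the number above, the martingale inequality of Assouad holds with
  \<open>D = (4 K + 8) K powr p \<le> 12 K ^ 3\<close>; the remaining factor comes from Doob's inequality, which
  is not available, and not needed, for \<open>p = 1\<close>.
\<close>
definition smooth_max_const :: "'b::real_normed_vector itself \<Rightarrow> real \<Rightarrow> real" where
  "smooth_max_const B p =
     (if p = 1 then 1 else 96 * smoothness_const B p ^ 3 * (p / (p - 1)) powr p)"

end

theory Submission
  imports Defs
begin

text \<open>
  By Abel summation the partial sum \<open>S k\<close> is \<open>s k E(X | F k) + D k\<close> with
  \<open>D k = (\<Sum>i<k. s i P i X)\<close>. For fixed \<open>n\<close> both \<open>S n - D k\<close> and \<open>D n - D k\<close> are reverse martingales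
  in \<open>k\<close>, started at \<open>S n\<close> and \<open>D n\<close> respectively. Doob's \<open>L\<^sup>p\<close> inequality for the first one gives
  part (i). For part (ii) use the second one: \<open>D n\<close> is a sum of (reverse) martingale differences, so
  \<open>E |D n|\<^sup>p\<close> is bounded by Assouad's inequality. For \<open>p = 1\<close> the triangle inequality suffices.
\<close>

section \<open>Equivalent norms\<close>


text \<open>Smoothness concerns some equivalent norm \<open>N\<close>, the claim concerns the given
  one; so conditional Jensen and the contraction of p-th moments are proved for an arbitrary
  equivalent norm and applied to both. Behind the moment bounds stands Young's inequality p u^(p-1)
  x \<le> (p-1) u^p + x^p: an estimate whose left side is p A is continued to (p-1) A + C, and
  cancelling (p-1) A leaves A \<le> C. Integrals take values in [0, \<infinity>], where only finite
  terms cancel; this is why finiteness of moments is tracked throughout, with a truncation where it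
  is not given. The increment s i P i is \<open>F i\<close>-measurable and centred given the smaller
  field \<open>F (Suc i)\<close>. Hence the sums over i from k to n - 1 form a martingale as k runs
  downwards. Adding any integrable \<open>F n\<close>-measurable term preserves this, and that
  freedom yields both S n and D n as the value at index 1. With q = p / (p - 1), the constants are
  built from 3^(p-1) for the convexity of the power on three summands and q^p for Doob's
  inequality.\<close>

locale renorming =
  fixes N :: "'b::{banach, second_countable_topology} \<Rightarrow> real"
  assumes equivalent_norm: "equivalent_norm N"
begin

lemma triangle: "N (x + y) \<le> N x + N y"
  and scaleR: "N (c *\<^sub>R x) = \<bar>c\<bar> * N x"
  using equivalent_norm unfolding equivalent_norm_def by auto

lemma zero [simp]: "N 0 = 0"
  using scaleR[of 0 0] by simp

lemma minus: "N (- x) = N x"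
  using scaleR[of "-1" x] by simp

lemma nonneg [simp]: "0 \<le> N x"
  using triangle[of x "- x"] by (simp add: minus)

lemma triangle_diff: "N (x - y) \<le> N x + N y"
  using triangle[of x "- y"] by (simp add: minus)

lemma le_add_diff: "N x \<le> N y + N (x - y)"
  using triangle[of y "x - y"] by simp

lemma eq_0_iff: "N x = 0 \<longleftrightarrow> x = 0"
proof
  obtain c where "c > 0" "c * norm x \<le> N x"
    using equivalent_norm unfolding equivalent_norm_def by blast
  then show "N x = 0 \<Longrightarrow> x = 0"
    by (simp add: mult_le_0_iff)
qed simp

text \<open>In the zero space the constant of the definition may be nonpositive. Positivity is
  wanted for a Lipschitz constant and for dividing by \<open>C\<close>.\<close>

lemma upper_bound: obtains C where "C > 0" "\<And>x. N x \<le> C * norm x"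
proof -
  obtain C where C: "N x \<le> C * norm x" for x
    using equivalent_norm unfolding equivalent_norm_def by blast
  have "N x \<le> max C 1 * norm x" for x
    by (rule order_trans[OF C]) (simp add: mult_right_mono)
  then show ?thesis
    by (intro that[of "max C 1"]) auto
qed

lemma sum_le: "N (sum f I) \<le> (\<Sum>i\<in>I. N (f i))"
proof (induction I rule: infinite_finite_induct)
  case (insert i I)
  then show ?case
    using triangle[of "f i" "sum f I"] by simp
qed auto

text \<open>The triangle inequality bounds the variation of \<open>N\<close> by
  \<open>N (x - y)\<close>, so \<open>N\<close> is Lipschitz for the given norm. This makes
  \<open>N\<close> Borel and lets it pass through limits of integrals.\<close>

lemma continuous_on: "continuous_on S N"
proof -
  obtain C where C: "C > 0" "\<And>x. N x \<le> C * norm x"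
    using upper_bound by blast
  have "\<bar>N x - N y\<bar> \<le> C * norm (x - y)" for x y
    using le_add_diff[of x y] le_add_diff[of y x] C(2)[of "x - y"] minus[of "x - y"] by simp
  then have "C-lipschitz_on S N"
    using C(1) by (intro lipschitz_onI) (auto simp: dist_norm)
  then show ?thesis
    by (rule lipschitz_on_continuous_on)
qed

lemma borel_measurable [measurable]: "N \<in> borel_measurable borel"
  by (intro borel_measurable_continuous_onI continuous_on)

lemma integrable: "integrable M (\<lambda>x. N (f x))" if "integrable M f" for M f
proof -
  obtain C where C: "C > 0" "\<And>x. N x \<le> C * norm x"
    using upper_bound by blast
  have [measurable]: "f \<in> borel_measurable M"
    using that by auto
  show ?thesis
  proof (rule Bochner_Integration.integrable_bound)
    show "integrable M (\<lambda>x. C * norm (f x))"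
      using that by simp
  qed (use C in auto)
qed

text \<open>For a simple function this is subadditivity of \<open>N\<close> on a finite sum over
  level sets. The general case follows by dominated convergence on both sides, along simple
  functions bounded by twice the norm of \<open>f\<close>.\<close>

lemma integral_le: "N (\<integral>x. f x \<partial>M) \<le> (\<integral>x. N (f x) \<partial>M)"
  if M: "finite_measure M" and f: "integrable M f" for f and M :: "'a measure"
proof -
  have [measurable]: "f \<in> borel_measurable M"
    using f by auto
  obtain s where "\<forall>i. simple_function M (s i)"
    "\<forall>x\<in>space M. (\<lambda>i. s i x) \<longlonglongrightarrow> f x"
    "\<forall>i. \<forall>x\<in>space M. dist (s i x) 0 \<le> 2 * dist (f x) 0"
    using borel_measurable_implies_sequence_metric[of f M 0] by auto
  then have s: "\<And>i. simple_function M (s i)"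
    "\<And>x. x \<in> space M \<Longrightarrow> (\<lambda>i. s i x) \<longlonglongrightarrow> f x"
    "\<And>i x. x \<in> space M \<Longrightarrow> norm (s i x) \<le> 2 * norm (f x)"
    by auto
  obtain C where C: "C > 0" "\<And>x. N x \<le> C * norm x"
    using upper_bound by blast
  have [measurable]: "s i \<in> borel_measurable M" for i
    using s(1) by (rule borel_measurable_simple_function)
  have int_s: "integrable M (s i)" for i
    by (rule Bochner_Integration.integrable_bound[of M "\<lambda>x. 2 * norm (f x)"]) (use f s(3) in auto)
  have simple: "N (\<integral>x. s i x \<partial>M) \<le> (\<integral>x. N (s i x) \<partial>M)" for i
  proof -
    define Y where "Y = s i ` space M - {0}"
    define A where "A y = {x \<in> space M. s i x = y}" for y
    have fin: "finite Y"
      using s(1)[of i] by (auto simp: Y_def simple_function_def)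
    have A[measurable]: "A y \<in> sets M" for y
      unfolding A_def by measurable
    have fin_A: "emeasure M (A y) < \<infinity>" for y
      using finite_measure.emeasure_finite[OF M, of "A y"] by (simp add: less_top[symmetric])
    have dec: "s i x = (\<Sum>y\<in>Y. indicator (A y) x *\<^sub>R y)" if "x \<in> space M" for x
    proof -
      have "(\<Sum>y\<in>Y. indicator (A y) x *\<^sub>R y) = (\<Sum>y\<in>Y. if y = s i x then y else 0)"
        using that by (intro sum.cong) (auto simp: A_def indicator_def)
      also have "\<dots> = s i x"
        using fin that by (auto simp: Y_def)
      finally show ?thesis ..
    qed
    have decN: "N (s i x) = (\<Sum>y\<in>Y. indicator (A y) x *\<^sub>R N y)" if "x \<in> space M" for x
    proof -
      have "(\<Sum>y\<in>Y. indicator (A y) x *\<^sub>R N y) = (\<Sum>y\<in>Y. if y = s i x then N y else 0)"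
        using that by (intro sum.cong) (auto simp: A_def indicator_def)
      also have "\<dots> = N (s i x)"
        using fin that by (auto simp: Y_def)
      finally show ?thesis ..
    qed
    have "(\<integral>x. s i x \<partial>M) = (\<integral>x. (\<Sum>y\<in>Y. indicator (A y) x *\<^sub>R y) \<partial>M)"
      by (intro Bochner_Integration.integral_cong dec refl)
    also have "\<dots> = (\<Sum>y\<in>Y. measure M (A y) *\<^sub>R y)"
      using fin_A by (subst Bochner_Integration.integral_sum) (auto intro!: sum.cong)
    also have "N \<dots> \<le> (\<Sum>y\<in>Y. measure M (A y) *\<^sub>R N y)"
      by (rule order_trans[OF sum_le]) (simp add: scaleR)
    also have "\<dots> = (\<integral>x. (\<Sum>y\<in>Y. indicator (A y) x *\<^sub>R N y) \<partial>M)"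
      using fin_A by (subst Bochner_Integration.integral_sum) (auto intro!: sum.cong)
    also have "\<dots> = (\<integral>x. N (s i x) \<partial>M)"
      by (intro Bochner_Integration.integral_cong decN[symmetric] refl)
    finally show ?thesis .
  qed
  have "(\<lambda>i. \<integral>x. s i x \<partial>M) \<longlonglongrightarrow> (\<integral>x. f x \<partial>M)"
    by (rule integral_dominated_convergence[where w = "\<lambda>x. 2 * norm (f x)"]) (use s f in auto)
  then have lim: "(\<lambda>i. N (\<integral>x. s i x \<partial>M)) \<longlonglongrightarrow> N (\<integral>x. f x \<partial>M)"
    by (rule continuous_on_tendsto_compose[OF continuous_on[of UNIV]]) auto
  have lim': "(\<lambda>i. \<integral>x. N (s i x) \<partial>M) \<longlonglongrightarrow> (\<integral>x. N (f x) \<partial>M)"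
  proof (rule integral_dominated_convergence[where w = "\<lambda>x. C * (2 * norm (f x))"])
    show "AE x in M. (\<lambda>i. N (s i x)) \<longlonglongrightarrow> N (f x)"
      by (rule AE_I2) (intro continuous_on_tendsto_compose[OF continuous_on[of UNIV]] s(2), auto)
    show "AE x in M. norm (N (s i x)) \<le> C * (2 * norm (f x))" for i
    proof (rule AE_I2)
      fix x assume "x \<in> space M"
      then show "norm (N (s i x)) \<le> C * (2 * norm (f x))"
        using order_trans[OF C(2)[of "s i x"] mult_left_mono[OF s(3)[of x i], of C]] C(1) by auto
    qed
  qed (use f in auto)
  show ?thesis
    by (rule LIMSEQ_le[OF lim lim']) (use simple in auto)
qed

end

lemma renorming_norm: "renorming (norm :: 'b::{banach, second_countable_topology} \<Rightarrow> real)"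
  by unfold_locales (auto simp: equivalent_norm_def norm_triangle_ineq intro!: exI[of _ 1])

section \<open>Conditional expectation in Banach spaces\<close>


locale conditioning = prob_space M for M :: "'a measure" +
  fixes G :: "'a measure"
  assumes subalg: "subalgebra M G"
begin

lemma sets_subalg: "A \<in> sets G \<Longrightarrow> A \<in> sets M"
  using subalg by (auto simp: subalgebra_def)

lemma measurable_subalg: "f \<in> measurable G L \<Longrightarrow> f \<in> measurable M L"
  by (rule measurable_from_subalg[OF subalg])

lemma is_cond_expectD:
  assumes "is_cond_expect M G Z W"
  shows "W \<in> borel_measurable G" "integrable M W"
    "A \<in> sets G \<Longrightarrow> (\<integral>x. indicator A x *\<^sub>R W x \<partial>M) = (\<integral>x. indicator A x *\<^sub>R Z x \<partial>M)"
  using assms by (auto simp: is_cond_expect_def set_lebesgue_integral_def)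

lemma is_cond_expectI:
  assumes "W \<in> borel_measurable G" "integrable M W"
    "\<And>A. A \<in> sets G \<Longrightarrow> (\<integral>x. indicator A x *\<^sub>R W x \<partial>M) = (\<integral>x. indicator A x *\<^sub>R Z x \<partial>M)"
  shows "is_cond_expect M G Z W"
  using assms by (auto simp: is_cond_expect_def set_lebesgue_integral_def)

lemma is_cond_expect_self: "is_cond_expect M G W W" if "W \<in> borel_measurable G" "integrable M W"
  using that by (intro is_cond_expectI) auto

lemma is_cond_expect_add:
  assumes Z: "integrable M Z" "integrable M Z'"
    and W: "is_cond_expect M G Z W" "is_cond_expect M G Z' W'"
  shows "is_cond_expect M G (\<lambda>x. Z x + Z' x) (\<lambda>x. W x + W' x)"
proof (rule is_cond_expectI)
  note D = is_cond_expectD[OF W(1)] is_cond_expectD[OF W(2)]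
  show "(\<lambda>x. W x + W' x) \<in> borel_measurable G"
    using D(1,4) by simp
  show "integrable M (\<lambda>x. W x + W' x)"
    using D(2,5) by simp
  fix A assume A: "A \<in> sets G"
  show "(\<integral>x. indicator A x *\<^sub>R (W x + W' x) \<partial>M) = (\<integral>x. indicator A x *\<^sub>R (Z x + Z' x) \<partial>M)"
    using Z D(2,5) D(3,6)[OF A] sets_subalg[OF A]
    by (simp add: scaleR_add_right integrable_mult_indicator)
qed

lemma is_cond_expect_scaleR:
  assumes W: "is_cond_expect M G Z W"
  shows "is_cond_expect M G (\<lambda>x. c *\<^sub>R Z x) (\<lambda>x. c *\<^sub>R W x)"
proof (rule is_cond_expectI)
  note D = is_cond_expectD[OF W]
  show "(\<lambda>x. c *\<^sub>R W x) \<in> borel_measurable G"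
    using D(1) by simp
  show "integrable M (\<lambda>x. c *\<^sub>R W x)"
    using D(2) by simp
  fix A assume A: "A \<in> sets G"
  show "(\<integral>x. indicator A x *\<^sub>R c *\<^sub>R W x \<partial>M) = (\<integral>x. indicator A x *\<^sub>R c *\<^sub>R Z x \<partial>M)"
    using D(3)[OF A] by (simp only: scaleR_left_commute[of _ c] integral_scaleR_right)
qed

lemma is_cond_expect_diff:
  assumes "integrable M Z" "integrable M Z'"
    and "is_cond_expect M G Z W" "is_cond_expect M G Z' W'"
  shows "is_cond_expect M G (\<lambda>x. Z x - Z' x) (\<lambda>x. W x - W' x)"
  using is_cond_expect_add[OF assms(1) _ assms(3) is_cond_expect_scaleR[OF assms(4), of "-1"]] assms(2)
  by simp

end

section \<open>Jensen's inequality and contraction of moments under conditioning\<close>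

locale conditioning_renorming = conditioning M G + renorming N
  for M G :: "'a measure" and N :: "'b::{banach, second_countable_topology} \<Rightarrow> real"
begin

text \<open>
  No Hahn-Banach theorem is used: on a countable partition of the space into sets of \<open>G\<close> on which
  \<open>W\<close> is constant up to \<open>\<epsilon>\<close>, the claim reduces to \<open>N (\<integral> Z) \<le> \<integral> N Z\<close>.
\<close>
lemma set_nn_integral_cond_expect_le:
  assumes Z: "integrable M Z" and W: "is_cond_expect M G Z W" and A: "A \<in> sets G"
  shows "(\<integral>\<^sup>+x\<in>A. N (W x) \<partial>M) \<le> (\<integral>\<^sup>+x\<in>A. N (Z x) \<partial>M)"
proof (rule ennreal_le_epsilon)
  fix e :: real assume e: "e > 0"
  note D = is_cond_expectD[OF W]
  obtain C where C: "C > 0" "\<And>x. N x \<le> C * norm x"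
    using upper_bound by blast
  \<comment> \<open>The error of replacing \<open>W\<close> by a constant enters twice below, each
    time at most \<open>C * \<epsilon>\<close> per unit of measure.\<close>
  define \<epsilon> where "\<epsilon> = e / (2 * C)"
  have \<epsilon>: "\<epsilon> > 0" "2 * (C * \<epsilon>) = e"
    using e C(1) by (auto simp: \<epsilon>_def field_simps)
  obtain S :: "'b set" where S: "countable S" "\<And>U. open U \<Longrightarrow> U \<noteq> {} \<Longrightarrow> \<exists>d\<in>S. d \<in> U"
    using countable_dense_setE by blast
  define d where "d = from_nat_into S"
  \<comment> \<open>\<open>d\<close> enumerates a dense set, and \<open>B i\<close> collects the
    points of \<open>A\<close> for which \<open>i\<close> is the first index with \<open>d i\<close>
    close to \<open>W\<close>. These sets lie in \<open>G\<close>, so the defining identity of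
    \<open>W\<close> holds on each of them.\<close>
  define B where "B = disjointed (\<lambda>i. {x \<in> space G. norm (W x - d i) < \<epsilon>} \<inter> A)"
  have [measurable]: "W \<in> borel_measurable G" "W \<in> borel_measurable M" "Z \<in> borel_measurable M"
    using D(1) measurable_subalg[OF D(1)] Z by auto
  have BG: "B i \<in> sets G" for i
  proof -
    have "range (\<lambda>i. {x \<in> space G. norm (W x - d i) < \<epsilon>} \<inter> A) \<subseteq> sets G"
      using A by auto
    from sets.range_disjointed_sets[OF this] show ?thesis
      unfolding B_def by blast
  qed
  then have B[measurable]: "B i \<in> sets M" for i
    by (rule sets_subalg)
  have disj: "disjoint_family B"
    unfolding B_def by (rule disjoint_family_disjointed)
  have close: "norm (W x - d i) < \<epsilon>" if "x \<in> B i" for x i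
    using that disjointed_subset[of "\<lambda>i. {x \<in> space G. norm (W x - d i) < \<epsilon>} \<inter> A" i]
    unfolding B_def by auto
  have AB: "A = (\<Union>i. B i)"
  proof -
    have "\<exists>i. norm (W x - d i) < \<epsilon>" for x
    proof -
      obtain y where "y \<in> S" "y \<in> ball (W x) \<epsilon>"
        using S(2)[of "ball (W x) \<epsilon>"] \<epsilon>(1) by auto
      moreover obtain i where "d i = y"
        using from_nat_into_surj[OF S(1) \<open>y \<in> S\<close>] unfolding d_def by auto
      ultimately show ?thesis
        by (auto simp: dist_norm)
    qed
    then show ?thesis
      using sets.sets_into_space[OF A] unfolding B_def UN_disjointed_eq by auto
  qed
  have piece: "(\<integral>\<^sup>+x\<in>B i. N (W x) \<partial>M) \<le> (\<integral>\<^sup>+x\<in>B i. N (Z x) \<partial>M) + e * emeasure M (B i)" for i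
  proof -
    have fin: "emeasure M (B i) < \<infinity>"
      by (simp add: less_top[symmetric])
    have ind: "integrable M (\<lambda>x. indicator (B i) x *\<^sub>R c)" for c :: "'c::{banach, second_countable_topology}"
      using B fin by simp
    have int: "integrable M (\<lambda>x. indicator (B i) x *\<^sub>R f x)"
      if "integrable M f" for f :: "'a \<Rightarrow> 'c::{banach, second_countable_topology}"
      using B that by (rule integrable_mult_indicator)
    have intN: "integrable M (\<lambda>x. indicator (B i) x * N (f x))" if "integrable M f" for f
      using int[OF integrable[OF that]] by simp
    have eq: "(\<integral>\<^sup>+x\<in>B i. N (f x) \<partial>M) = ennreal (\<integral>x. indicator (B i) x * N (f x) \<partial>M)"
      if "integrable M f" for f
      by (subst nn_integral_eq_integral[OF intN[OF that], symmetric])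
        (auto intro!: nn_integral_cong split: split_indicator)
    have N_ind: "N (indicator (B i) x *\<^sub>R y) = indicator (B i) x * N y" for x y
      by (simp add: scaleR)
    have near: "indicator (B i) x * N (W x - d i) \<le> indicator (B i) x * (C * \<epsilon>)" for x
      using C(1) order_trans[OF C(2)[of "W x - d i"] mult_left_mono[OF less_imp_le[OF close[of x i]], of C]]
      by (auto split: split_indicator)
    have dW: "integrable M (\<lambda>x. W x - d i)"
      using D(2) by simp
    have "(\<integral>x. indicator (B i) x * N (W x - d i) \<partial>M) \<le> (\<integral>x. indicator (B i) x * (C * \<epsilon>) \<partial>M)"
      using near intN[OF dW] ind[of "C * \<epsilon>"] by (intro integral_mono) auto
    then have small: "(\<integral>x. indicator (B i) x * N (W x - d i) \<partial>M) \<le> C * \<epsilon> * measure M (B i)"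
      by (simp add: mult.commute)
    \<comment> \<open>Replace \<open>W\<close> by the constant \<open>d i\<close>, for which
      \<open>N\<close> comes out of the integral with equality; then return to \<open>W\<close>
      inside \<open>N\<close>, where the set integral of \<open>W\<close> may be exchanged for that
      of \<open>Z\<close>.\<close>
    have "(\<integral>x. indicator (B i) x * N (W x) \<partial>M)
      \<le> (\<integral>x. indicator (B i) x * N (d i) + indicator (B i) x * N (W x - d i) \<partial>M)"
      using intN[OF D(2)] intN[OF dW] ind[of "N (d i)"] le_add_diff[of "W _" "d i"]
      by (intro integral_mono) (auto split: split_indicator)
    also have "\<dots> = measure M (B i) * N (d i) + (\<integral>x. indicator (B i) x * N (W x - d i) \<partial>M)"
      using intN[OF dW] ind[of "N (d i)"] by (subst Bochner_Integration.integral_add) auto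
    also have "measure M (B i) * N (d i) = N (\<integral>x. indicator (B i) x *\<^sub>R d i \<partial>M)"
      using fin by (simp add: scaleR)
    also have "(\<integral>x. indicator (B i) x *\<^sub>R d i \<partial>M)
      = (\<integral>x. indicator (B i) x *\<^sub>R W x - indicator (B i) x *\<^sub>R (W x - d i) \<partial>M)"
      by (intro Bochner_Integration.integral_cong) (auto simp: algebra_simps)
    also have "\<dots> = (\<integral>x. indicator (B i) x *\<^sub>R Z x \<partial>M) - (\<integral>x. indicator (B i) x *\<^sub>R (W x - d i) \<partial>M)"
      by (simp only: Bochner_Integration.integral_diff[OF int[OF D(2)] int[OF dW]] D(3)[OF BG])
    also have "N \<dots> \<le> (\<integral>x. indicator (B i) x * N (Z x) \<partial>M) + (\<integral>x. indicator (B i) x * N (W x - d i) \<partial>M)"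
      by (rule order_trans[OF triangle_diff], rule add_mono)
        (use integral_le[OF finite_measure_axioms int[OF Z]] integral_le[OF finite_measure_axioms int[OF dW]] in \<open>simp_all add: N_ind\<close>)
    finally have "(\<integral>x. indicator (B i) x * N (W x) \<partial>M)
      \<le> (\<integral>x. indicator (B i) x * N (Z x) \<partial>M) + e * measure M (B i)"
      using small \<epsilon>(2)[symmetric] by (simp add: algebra_simps)
    then show ?thesis
      using e by (simp add: eq[OF D(2)] eq[OF Z] emeasure_eq_measure ennreal_mult[symmetric]
          ennreal_plus[symmetric] del: ennreal_plus)
  qed
  have "(\<integral>\<^sup>+x\<in>A. N (W x) \<partial>M) = (\<Sum>i. \<integral>\<^sup>+x\<in>B i. N (W x) \<partial>M)"
    unfolding AB using disj by (intro nn_integral_disjoint_family) auto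
  also have "\<dots> \<le> (\<Sum>i. (\<integral>\<^sup>+x\<in>B i. N (Z x) \<partial>M) + e * emeasure M (B i))"
    by (intro suminf_le piece) auto
  also have "\<dots> = (\<Sum>i. \<integral>\<^sup>+x\<in>B i. N (Z x) \<partial>M) + e * (\<Sum>i. emeasure M (B i))"
    by (simp add: suminf_add[symmetric])
  also have "(\<Sum>i. \<integral>\<^sup>+x\<in>B i. N (Z x) \<partial>M) = (\<integral>\<^sup>+x\<in>A. N (Z x) \<partial>M)"
    unfolding AB using disj by (intro nn_integral_disjoint_family[symmetric]) auto
  also have "(\<Sum>i. emeasure M (B i)) = emeasure M A"
    unfolding AB using disj by (intro suminf_emeasure) auto
  also have "ennreal e * emeasure M A \<le> ennreal e"
    using mult_left_mono[OF emeasure_le_1[of A], of "ennreal e"] by simp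
  finally show "(\<integral>\<^sup>+x\<in>A. N (W x) \<partial>M) \<le> (\<integral>\<^sup>+x\<in>A. N (Z x) \<partial>M) + ennreal e"
    by simp
qed

text \<open>This is the inequality N (E(Z | G)) \<le> E(N Z | G) tested against nonnegative
  \<open>G\<close>-measurable weights. Indicators are the previous lemma; sums, multiples and
  monotone limits give the rest. Later weights are powers of truncated norms and of running
  maxima.\<close>

lemma nn_integral_mult_cond_expect_le:
  fixes g :: "'a \<Rightarrow> ennreal"
  assumes Z: "integrable M Z" and W: "is_cond_expect M G Z W" and g: "g \<in> borel_measurable G"
  shows "(\<integral>\<^sup>+x. g x * N (W x) \<partial>M) \<le> (\<integral>\<^sup>+x. g x * N (Z x) \<partial>M)"
  using g
proof (induction rule: borel_measurable_induct)
  case (cong f g)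
  have "(\<integral>\<^sup>+x. f x * u x \<partial>M) = (\<integral>\<^sup>+x. g x * u x \<partial>M)" for u
    using cong(3) subalg by (intro nn_integral_cong) (auto simp: subalgebra_def)
  then show ?case
    using cong(4) by simp
next
  case (set A)
  then show ?case
    using set_nn_integral_cond_expect_le[OF Z W] by (simp add: mult.commute)
next
  case (mult u c)
  have [measurable]: "u \<in> borel_measurable M" "W \<in> borel_measurable M" "Z \<in> borel_measurable M"
    using measurable_subalg[OF mult(2)] is_cond_expectD(2)[OF W] Z by auto
  show ?case
    using mult by (simp add: nn_integral_cmult mult.assoc mult_left_mono)
next
  case (add u v)
  have [measurable]: "u \<in> borel_measurable M" "v \<in> borel_measurable M"
    "W \<in> borel_measurable M" "Z \<in> borel_measurable M"
    using measurable_subalg[OF add(1)] measurable_subalg[OF add(3)] is_cond_expectD(2)[OF W] Z by auto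
  show ?case
    using add by (simp add: nn_integral_add distrib_right add_mono)
next
  case (seq U)
  have [measurable]: "U i \<in> borel_measurable M" "W \<in> borel_measurable M" "Z \<in> borel_measurable M" for i
    using measurable_subalg[OF seq(1)] is_cond_expectD(2)[OF W] Z by auto
  have *: "(\<integral>\<^sup>+x. (SUP i. U i) x * u x \<partial>M) = (SUP i. \<integral>\<^sup>+x. U i x * u x \<partial>M)"
    if [measurable]: "u \<in> borel_measurable M" for u
  proof -
    have "(\<integral>\<^sup>+x. (SUP i. U i) x * u x \<partial>M) = (\<integral>\<^sup>+x. (SUP i. U i x * u x) \<partial>M)"
      by (simp add: SUP_mult_right_ennreal image_comp)
    also have "\<dots> = (SUP i. \<integral>\<^sup>+x. U i x * u x \<partial>M)"
      using seq(3) by (intro nn_integral_monotone_convergence_SUP)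
        (auto simp: incseq_def le_fun_def intro!: mult_right_mono)
    finally show ?thesis .
  qed
  have NW: "(\<lambda>x. ennreal (N (W x))) \<in> borel_measurable M"
    and NZ: "(\<lambda>x. ennreal (N (Z x))) \<in> borel_measurable M"
    by measurable
  show ?case
    unfolding *[OF NW] *[OF NZ] using seq.IH by (intro SUP_mono) blast
qed

end


text \<open>Young's inequality for the conjugate exponents p and p / (p - 1), multiplied by p. The
  coefficient p - 1 falls short of p by exactly one, which is what survives when the
  \<open>u\<close> term is absorbed.\<close>

lemma young_powr:
  fixes u x p :: real
  assumes "1 < p" "0 \<le> u" "0 \<le> x"
  shows "p * (u powr (p - 1) * x) \<le> (p - 1) * u powr p + x powr p"
proof -
  have "x * u powr (p - 1) \<le> x powr p / p + (u powr (p - 1)) powr (p / (p - 1)) / (p / (p - 1))"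
    by (rule Youngs_inequality) (use assms in \<open>auto simp: field_simps\<close>)
  also have "(u powr (p - 1)) powr (p / (p - 1)) = u powr p"
    using assms by (simp add: powr_powr)
  finally show ?thesis
    using assms by (simp add: field_simps)
qed

text \<open>Test the weighted Jensen inequality with p w^(p-1), where w is \<open>N W\<close>
  truncated at \<open>m\<close>, and apply Young. The truncation makes the absorbed moment finite on
  a probability space; monotone convergence in \<open>m\<close> removes it.\<close>

lemma (in conditioning_renorming) nn_integral_powr_cond_expect_le:
  assumes p: "1 < p" and Z: "integrable M Z" and W: "is_cond_expect M G Z W"
  shows "(\<integral>\<^sup>+x. N (W x) powr p \<partial>M) \<le> (\<integral>\<^sup>+x. N (Z x) powr p \<partial>M)"
proof -
  have [measurable]: "W \<in> borel_measurable G" "W \<in> borel_measurable M" "Z \<in> borel_measurable M"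
    using is_cond_expectD[OF W] Z by auto
  define w where "w m x = min (N (W x)) (real m)" for m x
  have w0: "0 \<le> w m x" and wN: "w m x \<le> N (W x)" for m x
    by (auto simp: w_def)
  have [measurable]: "w m \<in> borel_measurable G" "w m \<in> borel_measurable M" for m
    unfolding w_def by measurable
  have bound: "(\<integral>\<^sup>+x. w m x powr p \<partial>M) \<le> (\<integral>\<^sup>+x. N (Z x) powr p \<partial>M)" for m
  proof -
    let ?I = "\<integral>\<^sup>+x. w m x powr p \<partial>M"
    have "?I \<le> (\<integral>\<^sup>+x. ennreal (real m powr p) \<partial>M)"
      using p by (intro nn_integral_mono ennreal_leI powr_mono2) (auto simp: w_def)
    then have fin: "?I < \<infinity>"
      by (simp add: emeasure_space_1 le_less_trans)
    \<comment> \<open>Split p as (p - 1) + 1: the first summand reappears on the right through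
      Young's inequality and cancels.\<close>
    have "ennreal (p - 1) * ?I + ?I = ennreal p * ?I"
      using p ennreal_plus[of "p - 1" 1] by (simp add: distrib_right)
    also have "\<dots> = (\<integral>\<^sup>+x. ennreal (p * w m x powr p) \<partial>M)"
      using p by (simp add: ennreal_mult nn_integral_cmult)
    also have "\<dots> \<le> (\<integral>\<^sup>+x. ennreal (p * w m x powr (p - 1)) * N (W x) \<partial>M)"
    proof (intro nn_integral_mono)
      fix x
      have "w m x powr p = w m x powr (p - 1) * w m x"
        using w0[of m x] by (cases "w m x = 0") (auto simp: powr_mult_base[symmetric] powr_diff)
      also have "p * \<dots> \<le> p * (w m x powr (p - 1) * N (W x))"
        using p wN by (intro mult_left_mono) auto
      finally show "ennreal (p * w m x powr p) \<le> ennreal (p * w m x powr (p - 1)) * N (W x)"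
        using p by (simp add: ennreal_mult[symmetric] mult.assoc)
    qed
    also have "\<dots> \<le> (\<integral>\<^sup>+x. ennreal (p * w m x powr (p - 1)) * N (Z x) \<partial>M)"
      by (rule nn_integral_mult_cond_expect_le[OF Z W]) measurable
    also have "\<dots> \<le> (\<integral>\<^sup>+x. ennreal ((p - 1) * w m x powr p) + ennreal (N (Z x) powr p) \<partial>M)"
      using p young_powr[OF p w0 nonneg]
      by (intro nn_integral_mono) (simp add: ennreal_mult[symmetric] mult.assoc flip: ennreal_plus)
    also have "\<dots> = ennreal (p - 1) * ?I + (\<integral>\<^sup>+x. N (Z x) powr p \<partial>M)"
      using p by (simp add: ennreal_mult nn_integral_cmult nn_integral_add)
    finally show ?thesis
      using fin p by (auto simp: ennreal_add_left_cancel_le ennreal_mult_eq_top_iff)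
  qed
  have "(SUP m. ennreal (w m x powr p)) = ennreal (N (W x) powr p)" for x
  proof (rule antisym)
    obtain m where "N (W x) \<le> real m"
      using real_arch_simple by blast
    then show "ennreal (N (W x) powr p) \<le> (SUP m. ennreal (w m x powr p))"
      by (intro SUP_upper2[of m]) (auto simp: w_def)
    show "(SUP m. ennreal (w m x powr p)) \<le> ennreal (N (W x) powr p)"
      using p w0 wN by (intro SUP_least ennreal_leI powr_mono2) auto
  qed
  then have "(\<integral>\<^sup>+x. N (W x) powr p \<partial>M) = (\<integral>\<^sup>+x. (SUP m. ennreal (w m x powr p)) \<partial>M)"
    by simp
  also have "\<dots> = (SUP m. \<integral>\<^sup>+x. w m x powr p \<partial>M)"
    using p w0 by (intro nn_integral_monotone_convergence_SUP)
      (auto simp: incseq_def le_fun_def w_def intro!: ennreal_leI powr_mono2 min.mono)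
  also have "\<dots> \<le> (\<integral>\<^sup>+x. N (Z x) powr p \<partial>M)"
    by (intro SUP_least bound)
  finally show ?thesis .
qed

section \<open>Existence of Banach-valued conditional expectations\<close>

context conditioning
begin

lemma cond_expect_L1_le:
  fixes Z :: "'a \<Rightarrow> 'b::{banach, second_countable_topology}"
  assumes Z: "integrable M Z" and W: "is_cond_expect M G Z W"
  shows "(\<integral>x. norm (W x) \<partial>M) \<le> (\<integral>x. norm (Z x) \<partial>M)"
proof -
  interpret renorming "norm :: 'b \<Rightarrow> real"
    by (rule renorming_norm)
  interpret conditioning_renorming M G "norm :: 'b \<Rightarrow> real" ..
  have "integrable M (\<lambda>x. norm (W x))"
    using is_cond_expectD(2)[OF W] by simp
  then show ?thesis
    using nn_integral_mult_cond_expect_le[OF Z W, of "\<lambda>_. 1"] Z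
    by (simp add: nn_integral_eq_integral integral_nonneg_AE)
qed

text \<open>Having a conditional expectation is a closed property in the mean. Take approximations
  at distance below 2^(-i); since conditioning contracts the mean norm, consecutive conditional
  expectations \<open>V i\<close> differ by at most 2 * 2^(-i), and their telescoping series
  converges absolutely almost everywhere. Its sum has the correct set integrals because those of
  \<open>V i\<close> and \<open>s i\<close> agree.\<close>

lemma is_cond_expect_closure:
  fixes f :: "'a \<Rightarrow> 'b::{banach, second_countable_topology}"
  assumes f: "integrable M f"
    and approx: "\<And>e. e > 0 \<Longrightarrow>
      \<exists>s W. integrable M s \<and> is_cond_expect M G s W \<and> (\<integral>x. norm (f x - s x) \<partial>M) < e"
  shows "\<exists>W. is_cond_expect M G f W"
proof -
  have "\<exists>s W. integrable M s \<and> is_cond_expect M G s W \<and> (\<integral>x. norm (f x - s x) \<partial>M) < (1/2) ^ i" for i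
    by (rule approx) simp
  then obtain s V where s: "\<And>i. integrable M (s i)" and V: "\<And>i. is_cond_expect M G (s i) (V i)"
    and close: "\<And>i. (\<integral>x. norm (f x - s i x) \<partial>M) < (1/2) ^ i"
    by metis
  define g where "g i x = V (Suc i) x - V i x" for i x
  have VG[measurable]: "V i \<in> borel_measurable G" for i
    by (rule is_cond_expectD(1)[OF V])
  have intV: "integrable M (V i)" for i
    by (rule is_cond_expectD(2)[OF V])
  have [measurable]: "V i \<in> borel_measurable M" for i
    using intV by auto
  have gG[measurable]: "g i \<in> borel_measurable G" "g i \<in> borel_measurable M" for i
    unfolding g_def by measurable
  have intg: "integrable M (g i)" for i
    unfolding g_def using intV by simp
  have norm_g: "(\<integral>x. norm (g i x) \<partial>M) \<le> 2 * (1/2) ^ i" for i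
  proof -
    have "(\<integral>x. norm (g i x) \<partial>M) \<le> (\<integral>x. norm (s (Suc i) x - s i x) \<partial>M)"
      unfolding g_def by (intro cond_expect_L1_le is_cond_expect_diff V s Bochner_Integration.integrable_diff)
    also have "\<dots> \<le> (\<integral>x. norm (f x - s i x) + norm (f x - s (Suc i) x) \<partial>M)"
      using f s by (intro integral_mono) (auto simp: norm_minus_commute intro!: norm_diff_triangle_le)
    also have "\<dots> = (\<integral>x. norm (f x - s i x) \<partial>M) + (\<integral>x. norm (f x - s (Suc i) x) \<partial>M)"
      using f s by simp
    also have "\<dots> \<le> (1/2) ^ i + (1/2) ^ Suc i"
      using close[of i] close[of "Suc i"] by linarith
    also have "\<dots> \<le> 2 * (1/2) ^ i"
      by simp
    finally show ?thesis .
  qed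
  have sum_norm_g: "summable (\<lambda>i. \<integral>x. norm (g i x) \<partial>M)"
  proof (rule summable_comparison_test')
    show "summable (\<lambda>i. 2 * (1/2) ^ i :: real)"
      by (intro summable_mult summable_geometric) simp
    show "norm (\<integral>x. norm (g i x) \<partial>M) \<le> 2 * (1/2) ^ i" if "i \<ge> 0" for i
      using norm_g[of i] by (simp add: integral_nonneg_AE)
  qed
  have AE_g: "AE x in M. summable (\<lambda>i. norm (g i x))"
  proof -
    have "(\<integral>\<^sup>+x. (\<Sum>i. ennreal (norm (g i x))) \<partial>M) = (\<Sum>i. ennreal (\<integral>x. norm (g i x) \<partial>M))"
      using intg by (simp add: nn_integral_suminf nn_integral_eq_integral)
    also have "\<dots> = ennreal (\<Sum>i. \<integral>x. norm (g i x) \<partial>M)"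
      using sum_norm_g by (intro suminf_ennreal2) (auto simp: integral_nonneg_AE)
    finally have "AE x in M. (\<Sum>i. ennreal (norm (g i x))) \<noteq> \<infinity>"
      by (intro nn_integral_PInf_AE) auto
    then show ?thesis
      by eventually_elim (rule summable_suminf_not_top, auto)
  qed
  \<comment> \<open>Where the series diverges, \<open>suminf\<close> has a fixed default value, so
    \<open>W\<close> is \<open>G\<close>-measurable without changing it on a null set.\<close>
  define W where "W x = V 0 x + (\<Sum>i. g i x)" for x
  have "is_cond_expect M G f W"
  proof (rule is_cond_expectI)
    show "W \<in> borel_measurable G"
      unfolding W_def by measurable
    have intsum: "integrable M (\<lambda>x. \<Sum>i. g i x)"
      by (rule integrable_suminf[OF intg AE_g sum_norm_g])
    then show "integrable M W"
      unfolding W_def using intV by simp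
    fix A assume "A \<in> sets G"
    then have A: "A \<in> sets G" "A \<in> sets M"
      using sets_subalg by auto
    let ?I = "\<lambda>h. \<integral>x. indicator A x *\<^sub>R h x \<partial>M"
    have intA: "integrable M (\<lambda>x. indicator A x *\<^sub>R h x)" if "integrable M h" for h :: "'a \<Rightarrow> 'b"
      by (rule integrable_mult_indicator[OF A(2) that])
    have "(\<lambda>i. ?I (g i)) sums (\<integral>x. (\<Sum>i. indicator A x *\<^sub>R g i x) \<partial>M)"
    proof (rule sums_integral)
      show "AE x in M. summable (\<lambda>i. norm (indicator A x *\<^sub>R g i x))"
        using AE_g by eventually_elim (auto split: split_indicator)
      show "summable (\<lambda>i. \<integral>x. norm (indicator A x *\<^sub>R g i x) \<partial>M)"
      proof (rule summable_comparison_test'[OF sum_norm_g])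
        fix i
        have "(\<integral>x. norm (indicator A x *\<^sub>R g i x) \<partial>M) \<le> (\<integral>x. norm (g i x) \<partial>M)"
          using integrable_norm[OF intA[OF intg]] integrable_norm[OF intg]
            by (intro integral_mono) (auto split: split_indicator)
        then show "norm (\<integral>x. norm (indicator A x *\<^sub>R g i x) \<partial>M) \<le> (\<integral>x. norm (g i x) \<partial>M)"
          by (simp add: integral_nonneg_AE)
      qed
    qed (rule intA[OF intg])
    also have "(\<integral>x. (\<Sum>i. indicator A x *\<^sub>R g i x) \<partial>M) = ?I (\<lambda>x. \<Sum>i. g i x)"
      by (intro Bochner_Integration.integral_cong) (auto split: split_indicator)
    also have "\<dots> = ?I W - ?I (V 0)"
      unfolding W_def scaleR_add_right
      by (subst Bochner_Integration.integral_add) (auto intro!: intA intV intsum)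
    finally have "(\<lambda>i. ?I (g i)) sums (?I W - ?I (V 0))" .
    moreover have "(\<Sum>i<m. ?I (g i)) = ?I (s m) - ?I (V 0)" for m
    proof -
      have "?I (g i) = ?I (V (Suc i)) - ?I (V i)" for i
        unfolding g_def scaleR_diff_right by (intro Bochner_Integration.integral_diff intA intV)
      then have "(\<Sum>i<m. ?I (g i)) = ?I (V m) - ?I (V 0)"
        using sum_lessThan_telescope[of "\<lambda>i. ?I (V i)" m] by simp
      then show ?thesis
        by (simp add: is_cond_expectD(3)[OF V A(1)])
    qed
    ultimately have "(\<lambda>m. ?I (s m) - ?I (V 0)) \<longlonglongrightarrow> ?I W - ?I (V 0)"
      by (simp add: sums_def)
    then have lim_W: "(\<lambda>m. ?I (s m)) \<longlonglongrightarrow> ?I W"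
      using tendsto_add[OF _ tendsto_const[of "?I (V 0)"]] by fastforce
    have "(\<lambda>m. ?I f - ?I (s m)) \<longlonglongrightarrow> 0"
      proof (rule Lim_null_comparison)
        show "\<forall>\<^sub>F m in sequentially. norm (?I f - ?I (s m)) \<le> (1/2) ^ m"
        proof (rule always_eventually, rule allI)
          fix m
          have "?I f - ?I (s m) = ?I (\<lambda>x. f x - s m x)"
            unfolding scaleR_diff_right
            by (intro Bochner_Integration.integral_diff[symmetric] intA f s)
          also have "norm \<dots> \<le> (\<integral>x. norm (indicator A x *\<^sub>R (f x - s m x)) \<partial>M)"
            by (rule integral_norm_bound)
          also have "\<dots> \<le> (\<integral>x. norm (f x - s m x) \<partial>M)"
            using f s integrable_norm[OF intA[of "\<lambda>x. f x - s m x"]]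
            by (intro integral_mono) (auto split: split_indicator)
          finally show "norm (?I f - ?I (s m)) \<le> (1/2) ^ m"
            using close[of m] by simp
        qed
        show "(\<lambda>m. (1/2) ^ m :: real) \<longlonglongrightarrow> 0"
          by (rule LIMSEQ_power_zero) simp
      qed
    then have "(\<lambda>m. ?I f - (?I f - ?I (s m))) \<longlonglongrightarrow> ?I f - 0"
      by (intro tendsto_diff tendsto_const)
    then have "(\<lambda>m. ?I (s m)) \<longlonglongrightarrow> ?I f"
      by simp
    with lim_W show "?I W = ?I f"
      by (rule LIMSEQ_unique)
  qed
  then show ?thesis
    by blast
qed

text \<open>For an indicator times a vector \<open>c\<close>, the scalar conditional expectation of
  the indicator times \<open>c\<close> will do. Linearity and closedness in the mean extend this to
  all integrable functions.\<close>

lemma ex_cond_expect: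
  fixes f :: "'a \<Rightarrow> 'b::{banach, second_countable_topology}"
  assumes "integrable M f"
  shows "\<exists>W. is_cond_expect M G f W"
  using assms
proof (induction rule: integrable_induct)
  case (base A c)
  interpret finite_measure_subalgebra M G
    by unfold_locales (rule subalg)
  let ?W = "real_cond_exp M G (indicator A)"
  have intA: "integrable M (indicator A :: 'a \<Rightarrow> real)"
    using base by simp
  have intW: "integrable M ?W"
    by (rule real_cond_exp_int(1)[OF intA])
  have "is_cond_expect M G (\<lambda>x. indicator A x *\<^sub>R c) (\<lambda>x. ?W x *\<^sub>R c)"
  proof (rule is_cond_expectI)
    show "(\<lambda>x. ?W x *\<^sub>R c) \<in> borel_measurable G"
      by (intro borel_measurable_scaleR borel_measurable_cond_exp) simp
    show "integrable M (\<lambda>x. ?W x *\<^sub>R c)"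
      using intW by simp
    fix B assume B: "B \<in> sets G"
    have "(\<integral>x. indicator B x *\<^sub>R ?W x \<partial>M) = (\<integral>x. indicator B x *\<^sub>R indicator A x \<partial>M)"
      using real_cond_exp_intA[OF intA B] by (simp add: set_lebesgue_integral_def)
    then show "(\<integral>x. indicator B x *\<^sub>R ?W x *\<^sub>R c \<partial>M) = (\<integral>x. indicator B x *\<^sub>R indicator A x *\<^sub>R c \<partial>M)"
      using integrable_mult_indicator[OF sets_subalg[OF B] intW]
        integrable_mult_indicator[OF sets_subalg[OF B] intA]
      by simp
  qed
  then show ?case
    by blast
next
  case (add f g)
  then show ?case
    using is_cond_expect_add by blast
next
  case (lim f s)
  have [measurable]: "f \<in> borel_measurable M" "s i \<in> borel_measurable M" for i
    using lim by auto
  have "(\<lambda>i. \<integral>x. norm (f x - s i x) \<partial>M) \<longlonglongrightarrow> (\<integral>x. 0 \<partial>M)"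
  \<comment> \<open>The factor 3 is 1 for \<open>f\<close> plus 2 for its simple approximations,
    which are bounded by twice the norm of \<open>f\<close>.\<close>
  proof (rule integral_dominated_convergence[where w = "\<lambda>x. 3 * norm (f x)"])
    show "AE x in M. (\<lambda>i. norm (f x - s i x)) \<longlonglongrightarrow> 0"
    proof (rule AE_I2)
      fix x assume "x \<in> space M"
      then have "(\<lambda>i. norm (f x - s i x)) \<longlonglongrightarrow> norm (f x - f x)"
        by (intro tendsto_intros lim.hyps(2))
      then show "(\<lambda>i. norm (f x - s i x)) \<longlonglongrightarrow> 0"
        by simp
    qed
    show "AE x in M. norm (norm (f x - s i x)) \<le> 3 * norm (f x)" for i
    proof (rule AE_I2)
      fix x assume "x \<in> space M"
      then show "norm (norm (f x - s i x)) \<le> 3 * norm (f x)"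
        using norm_triangle_ineq4[of "f x" "s i x"] lim.hyps(3)[of x i] by simp
    qed
  qed (use lim.hyps(4) in auto)
  then have conv: "(\<lambda>i. \<integral>x. norm (f x - s i x) \<partial>M) \<longlonglongrightarrow> 0"
    by simp
  show ?case
  proof (rule is_cond_expect_closure)
    fix e :: real assume "e > 0"
    then obtain i where "(\<integral>x. norm (f x - s i x) \<partial>M) < e"
      using order_tendstoD(2)[OF conv, of e] by (auto simp: eventually_sequentially)
    then show "\<exists>s W. integrable M s \<and> is_cond_expect M G s W \<and> (\<integral>x. norm (f x - s x) \<partial>M) < e"
      using lim.hyps(1) lim.IH by blast
  qed (rule lim.hyps(4))
qed

lemma is_cond_expect_cond_expect: "integrable M f \<Longrightarrow> is_cond_expect M G f (cond_expect M G f)"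
  unfolding cond_expect_def using ex_cond_expect by (rule someI_ex)

end

section \<open>Doob's maximal inequality\<close>


text \<open>With v = max u x this reads (p-1) (v^p - u^p) \<le> p (v^(p-1) - u^(p-1)) x. Both sides
  vanish if x sets no new record; otherwise v = x and the claim is Young's inequality. It is written
  without differences so that it can be integrated in [0, \<infinity>].\<close>

lemma doob_step:
  fixes u x p :: real
  assumes p: "1 < p" and u: "0 \<le> u" and x: "0 \<le> x"
  shows "(p - 1) * max u x powr p + p * (u powr (p - 1) * x)
    \<le> (p - 1) * u powr p + p * (max u x powr (p - 1) * x)"
proof (cases "u \<le> x")
  case True
  have "x powr (p - 1) * x = x powr p"
    using x by (cases "x = 0") (auto simp: powr_diff)
  then show ?thesis
    using True young_powr[OF p u x] by (simp add: max_def algebra_simps)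
qed (simp add: max_def)

text \<open>
  Summation by parts against the \<open>(p - 1)\<close>-st power of the running maximum replaces the usual
  layer cake formula and Hoelder inequality.
\<close>
lemma doob_maximal:
  fixes x :: "nat \<Rightarrow> 'a \<Rightarrow> real"
  assumes p: "1 < p"
    and [measurable]: "\<And>k. k \<le> n \<Longrightarrow> x k \<in> borel_measurable M"
    and nonneg: "\<And>k \<omega>. 0 \<le> x k \<omega>"
    and fin: "\<And>k. k \<le> n \<Longrightarrow> (\<integral>\<^sup>+\<omega>. x k \<omega> powr p \<partial>M) < \<infinity>"
    and sub: "\<And>k. k < n \<Longrightarrow>
      (\<integral>\<^sup>+\<omega>. ennreal ((MAX j\<in>{..k}. x j \<omega>) powr (p - 1)) * x k \<omega> \<partial>M)
      \<le> (\<integral>\<^sup>+\<omega>. ennreal ((MAX j\<in>{..k}. x j \<omega>) powr (p - 1)) * x (Suc k) \<omega> \<partial>M)"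
  shows "(\<integral>\<^sup>+\<omega>. (MAX k\<in>{..n}. x k \<omega>) powr p \<partial>M)
    \<le> ennreal ((p / (p - 1)) powr p) * (\<integral>\<^sup>+\<omega>. x n \<omega> powr p \<partial>M)"
proof -
  define u where "u k \<omega> = (MAX j\<in>{..k}. x j \<omega>)" for k \<omega>
  have u_0: "u 0 \<omega> = x 0 \<omega>" for \<omega>
    by (simp add: u_def)
  have u_Suc: "u (Suc k) \<omega> = max (u k \<omega>) (x (Suc k) \<omega>)" for k \<omega>
    unfolding u_def atMost_Suc by (subst image_insert, subst Max_insert) (auto simp: max.commute)
  have x_le_u: "x k \<omega> \<le> u k \<omega>" for k \<omega>
    unfolding u_def by (intro Max_ge) auto
  have u_nonneg: "0 \<le> u k \<omega>" for k \<omega>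
    using nonneg x_le_u order_trans by blast
  have u_meas[measurable]: "u k \<in> borel_measurable M" if "k \<le> n" for k
    using that
  proof (induction k)
    case 0
    have "u 0 = x 0"
      using u_0 by blast
    then show ?case
      by simp
  next
    case (Suc k)
    have "u (Suc k) = (\<lambda>\<omega>. max (u k \<omega>) (x (Suc k) \<omega>))"
      using u_Suc by blast
    moreover have "(\<lambda>\<omega>. max (u k \<omega>) (x (Suc k) \<omega>)) \<in> borel_measurable M"
      using Suc by (intro borel_measurable_max assms(2)) auto
    ultimately show ?case
      by simp
  qed
  have u_fin: "(\<integral>\<^sup>+\<omega>. u k \<omega> powr p \<partial>M) < \<infinity>" if "k \<le> n" for k
    using that
  proof (induction k)
    case 0
    then show ?case
      using fin[of 0] by (simp add: u_0)
  next
    case (Suc k)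
    note [measurable] = u_meas[of k] assms(2)[of "Suc k"]
    have "(\<integral>\<^sup>+\<omega>. u (Suc k) \<omega> powr p \<partial>M) \<le> (\<integral>\<^sup>+\<omega>. ennreal (u k \<omega> powr p) + ennreal (x (Suc k) \<omega> powr p) \<partial>M)"
      by (intro nn_integral_mono) (auto simp: u_Suc max_def)
    also have "\<dots> = (\<integral>\<^sup>+\<omega>. u k \<omega> powr p \<partial>M) + (\<integral>\<^sup>+\<omega>. x (Suc k) \<omega> powr p \<partial>M)"
      using Suc.prems by (intro nn_integral_add) auto
    also have "\<dots> < \<infinity>"
      using Suc.IH Suc.prems fin[of "Suc k"] by simp
    finally show ?case .
  qed
  \<comment> \<open>\<open>?J j k\<close> pairs the maximum up to time \<open>j\<close> with the
    variable at time \<open>k\<close>. The hypothesis \<open>sub\<close> compares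
    \<open>?J k k\<close> with \<open>?J k (Suc k)\<close>.\<close>
  let ?J = "\<lambda>j k. \<integral>\<^sup>+\<omega>. ennreal (p * (u j \<omega> powr (p - 1) * x k \<omega>)) \<partial>M"
  let ?U = "\<lambda>k. \<integral>\<^sup>+\<omega>. ennreal ((p - 1) * u k \<omega> powr p) \<partial>M"
  have U_eq: "?U k = ennreal (p - 1) * (\<integral>\<^sup>+\<omega>. u k \<omega> powr p \<partial>M)" if "k \<le> n" for k
    using p that by (simp add: ennreal_mult nn_integral_cmult)
  have U_fin: "?U k < \<infinity>" if "k \<le> n" for k
    using u_fin[OF that] unfolding U_eq[OF that] by (simp add: ennreal_mult_less_top)
  have young: "?J j k \<le> ?U j + (\<integral>\<^sup>+\<omega>. x k \<omega> powr p \<partial>M)" if "j \<le> n" "k \<le> n" for j k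
  proof -
    have "?J j k \<le> (\<integral>\<^sup>+\<omega>. ennreal ((p - 1) * u j \<omega> powr p) + ennreal (x k \<omega> powr p) \<partial>M)"
      using p young_powr[OF p u_nonneg nonneg] by (intro nn_integral_mono) (simp flip: ennreal_plus)
    also have "\<dots> = ?U j + (\<integral>\<^sup>+\<omega>. x k \<omega> powr p \<partial>M)"
      using that by (intro nn_integral_add) auto
    finally show ?thesis .
  qed
  have J_fin: "?J j k < \<infinity>" if "j \<le> n" "k \<le> n" for j k
    using le_less_trans[OF young[OF that]] U_fin[OF that(1)] fin[OF that(2)] by simp
  have J_mono: "?J k k \<le> ?J k (Suc k)" if "k < n" for k
  proof -
    have "?J k j = ennreal p * (\<integral>\<^sup>+\<omega>. ennreal (u k \<omega> powr (p - 1)) * x j \<omega> \<partial>M)" if "j \<le> n" for j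
      using p that \<open>k < n\<close> nonneg by (subst nn_integral_cmult[symmetric]) (auto simp: ennreal_mult)
    then show ?thesis
      using that sub[OF that] unfolding u_def[symmetric] by (simp add: mult_left_mono)
  qed
  \<comment> \<open>The inductive invariant is (p-1) E u^p \<le> p E u^(p-1) x at equal times. In
    the step the mixed term \<open>?J k (Suc k)\<close> stands on both sides of the integrated
    \<open>doob_step\<close> estimate and, being finite, cancels.\<close>
  have main: "?U k \<le> ?J k k" if "k \<le> n" for k
    using that
  proof (induction k)
    case 0
    have "(p - 1) * x 0 \<omega> powr p \<le> p * (x 0 \<omega> powr (p - 1) * x 0 \<omega>)" for \<omega>
      using p nonneg[of 0 \<omega>] by (cases "x 0 \<omega> = 0") (auto simp: powr_diff)
    then show ?case
      by (intro nn_integral_mono ennreal_leI) (simp add: u_0)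
  next
    case (Suc k)
    note [measurable] = u_meas[of k] u_meas[of "Suc k"] assms(2)[of "Suc k"]
    have "?J k (Suc k) + ?U (Suc k)
      = (\<integral>\<^sup>+\<omega>. ennreal (p * (u k \<omega> powr (p - 1) * x (Suc k) \<omega>)) + ennreal ((p - 1) * u (Suc k) \<omega> powr p) \<partial>M)"
      using Suc.prems by (intro nn_integral_add[symmetric]) auto
    also have "\<dots> \<le> (\<integral>\<^sup>+\<omega>. ennreal ((p - 1) * u k \<omega> powr p) + ennreal (p * (u (Suc k) \<omega> powr (p - 1) * x (Suc k) \<omega>)) \<partial>M)"
      using p doob_step[OF p u_nonneg nonneg] nonneg
      by (intro nn_integral_mono) (simp add: u_Suc add.commute flip: ennreal_plus)
    also have "\<dots> = ?U k + ?J (Suc k) (Suc k)"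
      using Suc.prems by (intro nn_integral_add) auto
    also have "?U k \<le> ?J k (Suc k)"
      using Suc J_mono[of k] by (auto intro: order_trans)
    finally have "?J k (Suc k) + ?U (Suc k) \<le> ?J k (Suc k) + ?J (Suc k) (Suc k)"
      by (simp add: add_right_mono)
    then show ?case
      using J_fin[of k "Suc k"] Suc.prems by (auto simp: ennreal_add_left_cancel_le)
  qed
  \<comment> \<open>Multiplying the invariant by q turns its left factor p - 1 into p = (p - 1) + 1.
    Young is then applied to q x in place of x, so the absorption leaves exactly the factor
    q^p.\<close>
  define q where "q = p / (p - 1)"
  have q: "q > 0" "q * (p - 1) = p"
    using p by (auto simp: q_def)
  have qx: "0 \<le> q * x n \<omega>" for \<omega>
    using q nonneg by simp
  let ?V = "\<integral>\<^sup>+\<omega>. u n \<omega> powr p \<partial>M"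
  let ?X = "\<integral>\<^sup>+\<omega>. ennreal ((q * x n \<omega>) powr p) \<partial>M"
  have "ennreal (p - 1) * ?V + ?V = ennreal q * ?U n"
    using q p ennreal_plus[of "p - 1" 1]
    by (simp add: U_eq distrib_right ennreal_mult[symmetric] mult.assoc[symmetric])
  also have "\<dots> \<le> ennreal q * ?J n n"
    using main[of n] by (simp add: mult_left_mono)
  also have "\<dots> = (\<integral>\<^sup>+\<omega>. ennreal (p * (u n \<omega> powr (p - 1) * (q * x n \<omega>))) \<partial>M)"
    using q p nonneg by (subst nn_integral_cmult[symmetric]) (auto simp: ennreal_mult[symmetric] mult_ac)
  also have "\<dots> \<le> (\<integral>\<^sup>+\<omega>. ennreal ((p - 1) * u n \<omega> powr p) + ennreal ((q * x n \<omega>) powr p) \<partial>M)"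
    using p q young_powr[OF p u_nonneg qx]
    by (intro nn_integral_mono) (simp flip: ennreal_plus)
  also have "\<dots> = ennreal (p - 1) * ?V + ?X"
    by (subst nn_integral_add) (auto simp: U_eq)
  finally have "?V \<le> ?X"
    using u_fin[of n] by (auto simp: ennreal_add_left_cancel_le ennreal_mult_eq_top_iff)
  also have "?X = ennreal (q powr p) * (\<integral>\<^sup>+\<omega>. x n \<omega> powr p \<partial>M)"
    using q nonneg by (subst nn_integral_cmult[symmetric]) (auto simp: powr_mult ennreal_mult)
  finally show ?thesis
    unfolding u_def q_def .
qed

section \<open>Smooth norms\<close>

text \<open>By homogeneity it suffices to treat unit vectors \<open>x\<close>, \<open>y\<close> and
  the pair x + \<tau> y, x - \<tau> y. For \<tau> \<le> 1 the modulus controls the sum of their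
  norms and the triangle inequality the difference, which bounds the sum of squares; concavity of
  the power p / 2 passes from squares to p-th powers. For \<tau> > 1 the triangle inequality is
  enough.\<close>

lemma (in renorming) smooth_powr_le:
  assumes p: "1 \<le> p" "p \<le> 2" and K: "1 \<le> K"
    and modulus: "\<And>\<tau>. \<tau> > 0 \<Longrightarrow> modulus_of_smoothness N \<tau> \<le> ereal (K * \<tau> powr p)"
  shows "N (x + y) powr p + N (x - y) powr p \<le> 2 * N x powr p + (4 * K + 8) * N y powr p"
proof -
  have unit: "N (x + \<tau> *\<^sub>R y) powr p + N (x - \<tau> *\<^sub>R y) powr p \<le> 2 + (4 * K + 8) * \<tau> powr p"
    if x: "N x = 1" and y: "N y = 1" and \<tau>: "\<tau> > 0" for x y \<tau>
  proof -
    define a where "a = N (x + \<tau> *\<^sub>R y)"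
    define b where "b = N (x - \<tau> *\<^sub>R y)"
    have ab: "0 \<le> a" "0 \<le> b" "a \<le> 1 + \<tau>" "b \<le> 1 + \<tau>"
      using triangle[of x "\<tau> *\<^sub>R y"] triangle_diff[of x "\<tau> *\<^sub>R y"] x y \<tau>
      by (auto simp: a_def b_def scaleR)
    show ?thesis
    proof (cases "\<tau> \<le> 1")
      case True
      have "ereal ((a + b) / 2 - 1) \<le> modulus_of_smoothness N \<tau>"
        unfolding modulus_of_smoothness_def a_def b_def using x y by (intro Sup_upper) auto
      then have "(a + b) / 2 - 1 \<le> K * \<tau> powr p"
        using order_trans[OF _ modulus[OF \<tau>], of "ereal ((a + b) / 2 - 1)"] by simp
      then have sum: "a + b \<le> 2 + 2 * (K * \<tau> powr p)"
        by (simp add: field_simps)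
      have "(x + \<tau> *\<^sub>R y) - (x - \<tau> *\<^sub>R y) = (2 * \<tau>) *\<^sub>R y"
        by (simp add: scaleR_2 flip: scaleR_scaleR)
      then have "N ((x + \<tau> *\<^sub>R y) - (x - \<tau> *\<^sub>R y)) = 2 * \<tau>"
        using y \<tau> by (simp add: scaleR)
      then have diff: "\<bar>a - b\<bar> \<le> 2 * \<tau>"
        using le_add_diff[of "x + \<tau> *\<^sub>R y" "x - \<tau> *\<^sub>R y"]
          le_add_diff[of "x - \<tau> *\<^sub>R y" "x + \<tau> *\<^sub>R y"]
          minus[of "(x + \<tau> *\<^sub>R y) - (x - \<tau> *\<^sub>R y)"]
        unfolding a_def b_def minus_diff_eq by (simp only: abs_le_iff minus_diff_eq) simp
      have t2: "\<tau>\<^sup>2 \<le> \<tau> powr p"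
        using powr_mono'[of p 2 \<tau>] p True \<tau> by simp
      \<comment> \<open>Here a + b = 2 + 2 m, and the parallelogram identity gives a^2 + b^2 - 2 = 4
        m + 2 m^2 + (a - b)^2 / 2. The modulus bounds the linear term by 4 K \<tau>^p; the two
        quadratic terms are at most 2 \<tau>^2 each, and \<tau>^2 \<le> \<tau>^p.\<close>
      define m where "m = (a + b) / 2 - 1"
      have m: "m \<le> K * \<tau> powr p" "m \<le> \<tau>" "0 \<le> m"
        using sum ab le_add_diff[of "2 *\<^sub>R x" "x - \<tau> *\<^sub>R y"] x scaleR[of 2 x]
        by (auto simp: m_def a_def b_def scaleR algebra_simps scaleR_2)
      have "m\<^sup>2 \<le> \<tau>\<^sup>2"
        using m by (intro power_mono)
      moreover have "(a - b)\<^sup>2 \<le> (2 * \<tau>)\<^sup>2"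
        using diff by (rule abs_le_square_iff[THEN iffD1, OF order_trans]) (use \<tau> in auto)
      moreover have "2 * (a\<^sup>2 + b\<^sup>2) = 4 * (1 + m)\<^sup>2 + (a - b)\<^sup>2"
        by (simp add: m_def power2_eq_square field_simps)
      ultimately have sq: "a\<^sup>2 + b\<^sup>2 - 2 \<le> (4 * K + 4) * \<tau> powr p"
        using m(1) t2 by (simp add: power2_eq_square algebra_simps)
      \<comment> \<open>Bernoulli for the concave power \<open>p / 2\<close> of the square\<close>
      have bern: "c powr p \<le> 1 + p / 2 * (c\<^sup>2 - 1)" if "0 \<le> c" for c :: real
      proof (cases "c = 0")
        case False
        have "(c\<^sup>2) powr (p / 2) * 1 powr (1 - p / 2) \<le> p / 2 * c\<^sup>2 + (1 - p / 2) * 1"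
          using p False by (intro Youngs_inequality_0) auto
        moreover have "(c\<^sup>2) powr (p / 2) = c powr p"
          using that False by (simp add: powr_powr flip: powr_numeral)
        ultimately show ?thesis
          by (simp add: algebra_simps)
      qed (use p in auto)
      have "a powr p + b powr p \<le> 2 + p / 2 * (a\<^sup>2 + b\<^sup>2 - 2)"
        using bern[OF ab(1)] bern[OF ab(2)] by (simp add: algebra_simps)
      also have "p / 2 * (a\<^sup>2 + b\<^sup>2 - 2) \<le> p / 2 * ((4 * K + 4) * \<tau> powr p)"
        using p by (intro mult_left_mono[OF sq]) auto
      also have "\<dots> \<le> 1 * ((4 * K + 4) * \<tau> powr p)"
        using p K by (intro mult_right_mono) auto
      also have "\<dots> \<le> (4 * K + 8) * \<tau> powr p"
        by (simp add: mult_right_mono)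
      finally show ?thesis
        by (simp add: a_def b_def)
    next
      case False
      \<comment> \<open>In this range 1 + \<tau> < 2 \<tau>; the 8 in the constant is 2 *
        2^2.\<close>
      have "a powr p + b powr p \<le> (2 * \<tau>) powr p + (2 * \<tau>) powr p"
        using ab False p by (intro add_mono powr_mono2) auto
      also have "\<dots> = 2 * (2 powr p * \<tau> powr p)"
        using \<tau> by (simp add: powr_mult)
      also have "2 powr p \<le> (4::real)"
        using powr_mono[of p 2 2] p by simp
      then have "2 * (2 powr p * \<tau> powr p) \<le> 2 * (4 * \<tau> powr p)"
        by (intro mult_left_mono mult_right_mono) auto
      also have "\<dots> \<le> 2 + (4 * K + 8) * \<tau> powr p"
        using K by (simp add: algebra_simps)
      finally show ?thesis
        by (simp add: a_def b_def)
    qed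
  qed
  show ?thesis
  proof (cases "x = 0 \<or> y = 0")
    case True
    then show ?thesis
      using K p by (auto simp: minus algebra_simps)
  next
    case False
    define r where "r = N x"
    define t where "t = N y"
    have rt: "r > 0" "t > 0"
      using False nonneg[of x] nonneg[of y] by (auto simp: r_def t_def eq_0_iff order_less_le)
    define x' where "x' = x /\<^sub>R r"
    define y' where "y' = y /\<^sub>R t"
    have u: "N x' = 1" "N y' = 1"
      using rt by (auto simp: x'_def y'_def scaleR r_def t_def)
    have eq: "x + y = r *\<^sub>R (x' + (t / r) *\<^sub>R y')" "x - y = r *\<^sub>R (x' - (t / r) *\<^sub>R y')"
      using rt by (auto simp: x'_def y'_def algebra_simps)
    have "N (x + y) powr p + N (x - y) powr p
      = r powr p * (N (x' + (t / r) *\<^sub>R y') powr p + N (x' - (t / r) *\<^sub>R y') powr p)"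
      unfolding eq scaleR using rt by (simp add: powr_mult distrib_left)
    also have "\<dots> \<le> r powr p * (2 + (4 * K + 8) * (t / r) powr p)"
      using rt by (intro mult_left_mono unit u) auto
    also have "\<dots> = 2 * r powr p + (4 * K + 8) * t powr p"
      using rt by (simp add: powr_divide algebra_simps)
    finally show ?thesis
      by (simp add: r_def t_def)
  qed
qed

text \<open>Dividing an admissible norm by its lower constant \<open>c\<close> makes it dominate the
  given norm, while unit vectors of the new norm become unit vectors of the old one after division
  by \<open>c\<close>. The maximum of 1, \<open>K\<close> and \<open>C / c\<close> then serves all
  three bounds, so the choice in the definition succeeds.\<close>

lemma smoothness_const:
  assumes "r_smooth TYPE('b::real_normed_vector) r"
  shows "1 \<le> smoothness_const TYPE('b) r \<and> (\<exists>N :: 'b \<Rightarrow> real. equivalent_norm N \<and>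
    (\<forall>x. norm x \<le> N x \<and> N x \<le> smoothness_const TYPE('b) r * norm x) \<and>
    (\<forall>\<tau>>0. modulus_of_smoothness N \<tau> \<le> ereal (smoothness_const TYPE('b) r * \<tau> powr r)))"
proof -
  let ?P = "\<lambda>K. 1 \<le> K \<and> (\<exists>N :: 'b \<Rightarrow> real. equivalent_norm N \<and>
        (\<forall>x. norm x \<le> N x \<and> N x \<le> K * norm x) \<and>
        (\<forall>\<tau>>0. modulus_of_smoothness N \<tau> \<le> ereal (K * \<tau> powr r)))"
  obtain N :: "'b \<Rightarrow> real" and K where N: "equivalent_norm N"
    and K: "\<And>\<tau>. \<tau> > 0 \<Longrightarrow> modulus_of_smoothness N \<tau> \<le> ereal (K * \<tau> powr r)"
    using assms unfolding r_smooth_def by blast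
  obtain c C where c: "c > 0" and cC: "\<And>x. c * norm x \<le> N x" "\<And>x. N x \<le> C * norm x"
    using N unfolding equivalent_norm_def by blast
  define L where "L = max 1 (max K (C / c))"
  define N' where "N' x = N x / c" for x
  have N'_bounds: "norm x \<le> N' x" "N' x \<le> L * norm x" for x
  proof -
    show "norm x \<le> N' x"
      using c cC(1)[of x] by (simp add: N'_def field_simps)
    have "N' x \<le> C / c * norm x"
      using c cC(2)[of x] by (simp add: N'_def field_simps)
    also have "\<dots> \<le> L * norm x"
      by (intro mult_right_mono) (auto simp: L_def)
    finally show "N' x \<le> L * norm x" .
  qed
  have "equivalent_norm N'"
    unfolding equivalent_norm_def
  proof (intro conjI allI)
    show "N' (x + y) \<le> N' x + N' y" for x y
      using N c by (simp add: N'_def equivalent_norm_def divide_right_mono flip: add_divide_distrib)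
    show "N' (t *\<^sub>R x) = \<bar>t\<bar> * N' x" for t x
      using N by (simp add: N'_def equivalent_norm_def)
    show "\<exists>c>0. \<exists>C. \<forall>x. c * norm x \<le> N' x \<and> N' x \<le> C * norm x"
      using N'_bounds by (intro exI[of _ 1] conjI exI[of _ L]) auto
  qed
  moreover have "modulus_of_smoothness N' \<tau> \<le> ereal (L * \<tau> powr r)" if \<tau>: "\<tau> > 0" for \<tau>
  proof -
    have scale: "N (t *\<^sub>R x) = \<bar>t\<bar> * N x" for t x
      using N by (simp add: equivalent_norm_def)
    have "modulus_of_smoothness N' \<tau> \<le> modulus_of_smoothness N \<tau>"
      unfolding modulus_of_smoothness_def
    proof (rule Sup_subset_mono, clarify)
      fix x y :: 'b
      assume "N' x = 1" "N' y = 1"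
      moreover have "N' z = N (z /\<^sub>R c)" for z
        using c by (simp add: N'_def scale field_simps)
      ultimately have "ereal ((N' (x + \<tau> *\<^sub>R y) + N' (x - \<tau> *\<^sub>R y)) / 2 - 1) =
          ereal ((N (x /\<^sub>R c + \<tau> *\<^sub>R (y /\<^sub>R c)) + N (x /\<^sub>R c - \<tau> *\<^sub>R (y /\<^sub>R c))) / 2 - 1)
          \<and> N (x /\<^sub>R c) = 1 \<and> N (y /\<^sub>R c) = 1"
        by (simp add: scaleR_add_right scaleR_diff_right mult.commute)
      then show "\<exists>x' y'. ereal ((N' (x + \<tau> *\<^sub>R y) + N' (x - \<tau> *\<^sub>R y)) / 2 - 1) =
          ereal ((N (x' + \<tau> *\<^sub>R y') + N (x' - \<tau> *\<^sub>R y')) / 2 - 1) \<and> N x' = 1 \<and> N y' = 1"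
        by blast
    qed
    also have "\<dots> \<le> ereal (K * \<tau> powr r)"
      by (rule K[OF \<tau>])
    also have "\<dots> \<le> ereal (L * \<tau> powr r)"
      by (auto simp: L_def intro!: mult_right_mono)
    finally show ?thesis .
  qed
  ultimately have "?P L"
    using N'_bounds by (auto simp: L_def intro!: exI[of _ N'])
  then show ?thesis
    unfolding smoothness_const_def by (rule someI)
qed

section \<open>Reverse martingales\<close>


text \<open>Convexity of the power at the mean m of the three numbers: Young's inequality with u = m
  is the tangent line bound, and summing it over the three numbers uses a + b + c = 3 m.\<close>

lemma powr_add3_le:
  fixes a b c p :: real
  assumes p: "1 < p" and "0 \<le> a" "0 \<le> b" "0 \<le> c"
  shows "(a + b + c) powr p \<le> 3 powr (p - 1) * (a powr p + b powr p + c powr p)"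
proof -
  define m where "m = (a + b + c) / 3"
  have m: "0 \<le> m" "a + b + c = 3 * m"
    using assms by (auto simp: m_def)
  have "m powr (p - 1) * m = m powr p"
    using m(1) by (cases "m = 0") (auto simp: powr_diff)
  then have "3 * (p * m powr p) = p * (m powr (p - 1) * a) + p * (m powr (p - 1) * b) + p * (m powr (p - 1) * c)"
    using m(2) by (metis (no_types, opaque_lifting) distrib_left mult.left_commute)
  also have "\<dots> \<le> 3 * ((p - 1) * m powr p) + (a powr p + b powr p + c powr p)"
    using young_powr[OF p m(1)] assms(2-4) by smt
  finally have "3 * m powr p \<le> a powr p + b powr p + c powr p"
    by (simp add: algebra_simps)
  then have "3 powr (p - 1) * (3 * m powr p) \<le> 3 powr (p - 1) * (a powr p + b powr p + c powr p)"
    by (intro mult_left_mono) auto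
  also have "3 powr (p - 1) * (3 * m powr p) = (a + b + c) powr p"
    using m by (simp add: powr_mult powr_diff)
  finally show ?thesis .
qed

lemma nn_integral_powr_add_finite:
  fixes f g :: "'a \<Rightarrow> 'b::{real_normed_vector, second_countable_topology}"
  assumes p: "1 < p" and [measurable]: "f \<in> borel_measurable M" "g \<in> borel_measurable M"
    and "(\<integral>\<^sup>+x. norm (f x) powr p \<partial>M) < \<infinity>" "(\<integral>\<^sup>+x. norm (g x) powr p \<partial>M) < \<infinity>"
  shows "(\<integral>\<^sup>+x. norm (f x + g x) powr p \<partial>M) < \<infinity>"
proof -
  have "norm (f x + g x) powr p \<le> 3 powr (p - 1) * (norm (f x) powr p + norm (g x) powr p)" for x
  proof -
    have "norm (f x + g x) powr p \<le> (norm (f x) + norm (g x) + 0) powr p"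
      using p norm_triangle_ineq[of "f x" "g x"] by (intro powr_mono2) auto
    also have "\<dots> \<le> 3 powr (p - 1) * (norm (f x) powr p + norm (g x) powr p + 0 powr p)"
      using p by (intro powr_add3_le) auto
    finally show ?thesis
      by simp
  qed
  then have "(\<integral>\<^sup>+x. norm (f x + g x) powr p \<partial>M)
    \<le> (\<integral>\<^sup>+x. ennreal (3 powr (p - 1)) * (ennreal (norm (f x) powr p) + ennreal (norm (g x) powr p)) \<partial>M)"
    by (intro nn_integral_mono) (simp add: ennreal_mult[symmetric] flip: ennreal_plus)
  also have "\<dots> = ennreal (3 powr (p - 1)) * ((\<integral>\<^sup>+x. norm (f x) powr p \<partial>M) + (\<integral>\<^sup>+x. norm (g x) powr p \<partial>M))"
    by (simp add: nn_integral_cmult nn_integral_add)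
  also have "\<dots> < \<infinity>"
    using assms(4,5) by (simp add: ennreal_mult_less_top)
  finally show ?thesis .
qed

lemma nn_integral_powr_scaleR_finite:
  assumes "(\<integral>\<^sup>+x. norm (f x) powr p \<partial>M) < \<infinity>"
    and [measurable]: "f \<in> borel_measurable M"
  shows "(\<integral>\<^sup>+x. norm (c *\<^sub>R f x :: 'b::{real_normed_vector, second_countable_topology}) powr p \<partial>M) < \<infinity>"
proof -
  have "(\<integral>\<^sup>+x. norm (c *\<^sub>R f x) powr p \<partial>M) = ennreal (\<bar>c\<bar> powr p) * (\<integral>\<^sup>+x. norm (f x) powr p \<partial>M)"
    by (subst nn_integral_cmult[symmetric]) (auto simp: powr_mult ennreal_mult)
  then show ?thesis
    using assms by (simp add: ennreal_mult_less_top)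
qed

text \<open>One step of Assouad's inequality. Integrate the two-point inequality for S + Y and S -
  Y. As \<open>S\<close> is the conditional expectation of S - Y, the moment of the reflected term
  is at least that of \<open>S\<close> and cancels one of the two copies on the right.\<close>

lemma (in conditioning_renorming) nn_integral_powr_add_martingale_diff_le:
  assumes p: "1 < p" and c: "0 \<le> c"
    and smooth: "\<And>x y. N (x + y) powr p + N (x - y) powr p \<le> 2 * N x powr p + c * N y powr p"
    and S: "S \<in> borel_measurable G" "integrable M S" "(\<integral>\<^sup>+x. N (S x) powr p \<partial>M) < \<infinity>"
    and Y: "integrable M Y" "is_cond_expect M G Y (\<lambda>_. 0)"
  shows "(\<integral>\<^sup>+x. N (S x + Y x) powr p \<partial>M)
    \<le> (\<integral>\<^sup>+x. N (S x) powr p \<partial>M) + ennreal c * (\<integral>\<^sup>+x. N (Y x) powr p \<partial>M)"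
proof -
  let ?I = "\<lambda>f. \<integral>\<^sup>+x. N (f x) powr p \<partial>M"
  have [measurable]: "S \<in> borel_measurable M" "Y \<in> borel_measurable M"
    using S(2) Y(1) by auto
  have "is_cond_expect M G (\<lambda>x. S x - Y x) S"
    using is_cond_expect_diff[OF S(2) Y(1) is_cond_expect_self[OF S(1,2)] Y(2)] by simp
  then have "?I S \<le> ?I (\<lambda>x. S x - Y x)"
    using S(2) Y(1) p by (intro nn_integral_powr_cond_expect_le) auto
  then have "?I S + ?I (\<lambda>x. S x + Y x) \<le> ?I (\<lambda>x. S x + Y x) + ?I (\<lambda>x. S x - Y x)"
    by (simp add: add.commute add_left_mono)
  also have "\<dots> = (\<integral>\<^sup>+x. ennreal (N (S x + Y x) powr p) + ennreal (N (S x - Y x) powr p) \<partial>M)"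
    by (intro nn_integral_add[symmetric]) auto
  also have "\<dots> \<le> (\<integral>\<^sup>+x. (ennreal (N (S x) powr p) + ennreal (N (S x) powr p)) + ennreal c * ennreal (N (Y x) powr p) \<partial>M)"
    using smooth c by (intro nn_integral_mono) (simp add: ennreal_mult[symmetric] flip: ennreal_plus)
  also have "\<dots> = ?I S + (?I S + ennreal c * ?I Y)"
    by (simp add: nn_integral_add nn_integral_cmult add.assoc)
  finally show ?thesis
    using S(3) by (auto simp: ennreal_add_left_cancel_le)
qed

section \<open>Martingales along a decreasing sequence of sigma-fields\<close>

locale reverse_filtration = prob_space M for M :: "'a measure" +
  fixes F :: "nat \<Rightarrow> 'a measure"
  assumes decreasing: "decreasing_subfields M F"
begin

lemma conditioning: "1 \<le> k \<Longrightarrow> conditioning M (F k)"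
  using decreasing by unfold_locales (auto simp: decreasing_subfields_def)

lemma subalgebra_mono:
  assumes "1 \<le> k" "k \<le> l"
  shows "subalgebra (F k) (F l)"
proof -
  have "sets (F l) \<subseteq> sets (F k)"
    using assms(2,1)
  proof (induction rule: dec_induct)
    case (step m)
    then have "sets (F (Suc m)) \<subseteq> sets (F m)"
      using decreasing by (simp add: decreasing_subfields_def)
    with step show ?case
      by blast
  qed simp
  moreover have "space (F k) = space M" "space (F l) = space M"
    using assms decreasing by (auto simp: decreasing_subfields_def subalgebra_def)
  ultimately show ?thesis
    by (auto simp: subalgebra_def)
qed

lemma measurable_mono: "1 \<le> k \<Longrightarrow> k \<le> l \<Longrightarrow> f \<in> measurable (F l) L \<Longrightarrow> f \<in> measurable (F k) L"
  using subalgebra_mono by (rule measurable_from_subalg)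

text \<open>Every step conditions on a smaller field and contracts the moment. Finiteness at index 1
  thus carries over to all indices.\<close>

lemma reverse_martingale_powr_le:
  fixes U :: "nat \<Rightarrow> 'a \<Rightarrow> 'b::{banach, second_countable_topology}"
  assumes p: "1 < p"
    and int: "\<And>k. 1 \<le> k \<Longrightarrow> k \<le> n \<Longrightarrow> integrable M (U k)"
    and mart: "\<And>k. 1 \<le> k \<Longrightarrow> k < n \<Longrightarrow> is_cond_expect M (F (Suc k)) (U k) (U (Suc k))"
    and k: "1 \<le> k" "k \<le> n"
  shows "(\<integral>\<^sup>+\<omega>. norm (U k \<omega>) powr p \<partial>M) \<le> (\<integral>\<^sup>+\<omega>. norm (U 1 \<omega>) powr p \<partial>M)"
  using k
proof (induction rule: dec_induct)
  case (step k)
  interpret renorming "norm :: 'b \<Rightarrow> real"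
    by (rule renorming_norm)
  interpret conditioning M "F (Suc k)"
    by (rule conditioning) simp
  interpret conditioning_renorming M "F (Suc k)" "norm :: 'b \<Rightarrow> real" ..
  have "(\<integral>\<^sup>+\<omega>. norm (U (Suc k) \<omega>) powr p \<partial>M) \<le> (\<integral>\<^sup>+\<omega>. norm (U k \<omega>) powr p \<partial>M)"
    using step by (intro nn_integral_powr_cond_expect_le[OF p] int mart) auto
  then show ?case
    using step by auto
qed simp

text \<open>Time reversal: the norms of U n, ..., U 1 form a nonnegative submartingale for the
  increasing fields F n, ..., F 1, whose last member is the norm of U 1. The running maximum up to
  \<open>U (n - k)\<close> is \<open>F (n - k)\<close>-measurable, hence an admissible weight in the
  conditional Jensen inequality.\<close>

lemma reverse_doob_maximal:
  fixes U :: "nat \<Rightarrow> 'a \<Rightarrow> 'b::{banach, second_countable_topology}"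
  assumes p: "1 < p" and n: "1 \<le> n"
    and U: "\<And>k. 1 \<le> k \<Longrightarrow> k \<le> n \<Longrightarrow> U k \<in> borel_measurable (F k)"
    and int: "\<And>k. 1 \<le> k \<Longrightarrow> k \<le> n \<Longrightarrow> integrable M (U k)"
    and mart: "\<And>k. 1 \<le> k \<Longrightarrow> k < n \<Longrightarrow> is_cond_expect M (F (Suc k)) (U k) (U (Suc k))"
    and fin: "(\<integral>\<^sup>+\<omega>. norm (U 1 \<omega>) powr p \<partial>M) < \<infinity>"
  shows "(\<integral>\<^sup>+\<omega>. (MAX k\<in>{1..n}. norm (U k \<omega>)) powr p \<partial>M)
    \<le> ennreal ((p / (p - 1)) powr p) * (\<integral>\<^sup>+\<omega>. norm (U 1 \<omega>) powr p \<partial>M)"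
proof -
  define x where "x k \<omega> = norm (U (n - k) \<omega>)" for k \<omega>
  have "(\<integral>\<^sup>+\<omega>. (MAX k\<in>{..n - 1}. x k \<omega>) powr p \<partial>M)
    \<le> ennreal ((p / (p - 1)) powr p) * (\<integral>\<^sup>+\<omega>. x (n - 1) \<omega> powr p \<partial>M)"
  proof (rule doob_maximal[OF p])
    fix k assume "k \<le> n - 1"
    then have k: "1 \<le> n - k" "n - k \<le> n"
      using n by auto
    show "x k \<in> borel_measurable M"
      using int[OF k] unfolding x_def by auto
    show "(\<integral>\<^sup>+\<omega>. x k \<omega> powr p \<partial>M) < \<infinity>"
      unfolding x_def by (rule le_less_trans[OF reverse_martingale_powr_le[OF p int mart k] fin])
  next
    fix k assume k: "k < n - 1"
    \<comment> \<open>The reversed step from \<open>k\<close> to \<open>Suc k\<close> goes from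
      \<open>U (n - k)\<close> back to \<open>U (n - Suc k)\<close>, of which the former is the
      conditional expectation given \<open>F (n - k)\<close>.\<close>
    then have Suc_k: "Suc (n - Suc k) = n - k" "1 \<le> n - Suc k" "1 \<le> n - k"
      by auto
    interpret renorming "norm :: 'b \<Rightarrow> real"
      by (rule renorming_norm)
    interpret conditioning M "F (n - k)"
      by (rule conditioning[OF Suc_k(3)])
    interpret conditioning_renorming M "F (n - k)" "norm :: 'b \<Rightarrow> real" ..
    have "x j \<in> borel_measurable (F (n - k))" if "j \<le> k" for j
    proof -
      have [measurable]: "U (n - j) \<in> borel_measurable (F (n - k))"
        using that k by (intro measurable_mono[of "n - k" "n - j"] U) auto
      show ?thesis
        unfolding x_def by measurable
    qed
    then have "(\<lambda>\<omega>. MAX j\<in>{..k}. x j \<omega>) \<in> borel_measurable (F (n - k))"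
      by (intro borel_measurable_Max) auto
    then have g: "(\<lambda>\<omega>. ennreal ((MAX j\<in>{..k}. x j \<omega>) powr (p - 1))) \<in> borel_measurable (F (n - k))"
      by measurable
    show "(\<integral>\<^sup>+\<omega>. ennreal ((MAX j\<in>{..k}. x j \<omega>) powr (p - 1)) * x k \<omega> \<partial>M)
      \<le> (\<integral>\<^sup>+\<omega>. ennreal ((MAX j\<in>{..k}. x j \<omega>) powr (p - 1)) * x (Suc k) \<omega> \<partial>M)"
      unfolding x_def[of k] x_def[of "Suc k"]
      using int[OF Suc_k(2)] mart[of "n - Suc k"] Suc_k k
      by (intro nn_integral_mult_cond_expect_le[OF _ _ g]) auto
  qed (simp add: x_def)
  moreover have "(\<lambda>k. n - k) ` {..n - 1} = {1..n}"
  proof (intro equalityI subsetI)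
    fix k assume "k \<in> {1..n}"
    then have "k = n - (n - k)" "n - k \<in> {..n - 1}"
      by auto
    then show "k \<in> (\<lambda>k. n - k) ` {..n - 1}"
      by blast
  qed (use n in auto)
  then have "(MAX k\<in>{..n - 1}. x k \<omega>) = (MAX k\<in>{1..n}. norm (U k \<omega>))" for \<omega>
    unfolding x_def by (metis (no_types, lifting) image_cong image_image)
  ultimately show ?thesis
    using n by (simp add: x_def)
qed

end

section \<open>Abel summation and the reverse martingales of the weighted sums\<close>

text \<open>
  \<open>U R\<close> is the reverse martingale with terminal value \<open>U R n = R\<close> and increments \<open>s k *\<^sub>R P k\<close>.
  For \<open>R = s n *\<^sub>R e n\<close> it starts at \<open>S n\<close> (part (i)), for \<open>R = 0\<close> at \<open>D n\<close> (part (ii)).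
\<close>
locale weighted_projections = reverse_filtration M F
  for M :: "'a measure" and F +
  fixes a :: "nat \<Rightarrow> real" and X :: "'a \<Rightarrow> 'b::{banach, second_countable_topology}"
    and p :: real and n :: nat
  assumes p_ge_1: "1 \<le> p" and n_ge_1: "1 \<le> n"
    and X_measurable [measurable]: "X \<in> borel_measurable M"
    and X_Lp: "(\<integral>\<^sup>+\<omega>. norm (X \<omega>) powr p \<partial>M) < \<infinity>"
begin

abbreviation e :: "nat \<Rightarrow> 'a \<Rightarrow> 'b" where "e k \<equiv> cond_expect M (F k) X"
abbreviation P :: "nat \<Rightarrow> 'a \<Rightarrow> 'b" where "P k \<equiv> proj_diff M F k X"
abbreviation s :: "nat \<Rightarrow> real" where "s k \<equiv> \<Sum>i=1..k. a i"
abbreviation S :: "nat \<Rightarrow> 'a \<Rightarrow> 'b" where "S k \<omega> \<equiv> \<Sum>j=1..k. a j *\<^sub>R e j \<omega>"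

definition U :: "('a \<Rightarrow> 'b) \<Rightarrow> nat \<Rightarrow> 'a \<Rightarrow> 'b"
  where "U R k \<omega> = R \<omega> + (\<Sum>i=k..<n. s i *\<^sub>R P i \<omega>)"

lemma X_integrable: "integrable M X"
proof (rule integrableI_bounded)
  have "norm (X \<omega>) \<le> 1 + norm (X \<omega>) powr p" for \<omega>
  proof (cases "norm (X \<omega>) \<le> 1")
    case False
    then have "norm (X \<omega>) powr 1 \<le> norm (X \<omega>) powr p"
      using p_ge_1 by (intro powr_mono) auto
    then show ?thesis
      using False by simp
  qed (simp add: add_increasing2)
  then have "(\<integral>\<^sup>+\<omega>. norm (X \<omega>) \<partial>M) \<le> (\<integral>\<^sup>+\<omega>. ennreal 1 + ennreal (norm (X \<omega>) powr p) \<partial>M)"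
    by (intro nn_integral_mono) (simp flip: ennreal_plus del: ennreal_1)
  also have "\<dots> = 1 + (\<integral>\<^sup>+\<omega>. norm (X \<omega>) powr p \<partial>M)"
    by (subst nn_integral_add) (auto simp: emeasure_space_1)
  also have "\<dots> < \<infinity>"
    using X_Lp by simp
  finally show "(\<integral>\<^sup>+\<omega>. norm (X \<omega>) \<partial>M) < \<infinity>" .
qed simp

lemma is_cond_expect_e: "1 \<le> k \<Longrightarrow> is_cond_expect M (F k) X (e k)"
  by (rule conditioning.is_cond_expect_cond_expect[OF conditioning X_integrable])

lemma e_measurable: "1 \<le> k \<Longrightarrow> e k \<in> borel_measurable (F k)"
  and e_integrable: "1 \<le> k \<Longrightarrow> integrable M (e k)"
  using is_cond_expect_e by (auto simp: is_cond_expect_def)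

lemma e_measurable_M [measurable]: "1 \<le> k \<Longrightarrow> e k \<in> borel_measurable M"
  using e_integrable by auto

text \<open>Tower property: a set of \<open>F (Suc k)\<close> also lies in \<open>F k\<close>, so
  \<open>e k\<close> and \<open>e (Suc k)\<close> both have the integral of \<open>X\<close> over
  it.\<close>

lemma is_cond_expect_e_Suc: "1 \<le> k \<Longrightarrow> is_cond_expect M (F (Suc k)) (e k) (e (Suc k))"
  using is_cond_expect_e[of k] is_cond_expect_e[of "Suc k"] subalgebra_mono[of k "Suc k"]
  unfolding is_cond_expect_def subalgebra_def by (auto simp: subset_iff)

lemma P_measurable: "1 \<le> k \<Longrightarrow> P k \<in> borel_measurable (F k)"
  using measurable_mono[OF _ _ e_measurable[of "Suc k"], of k] e_measurable[of k]
  unfolding proj_diff_def by (intro borel_measurable_diff) auto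

lemma P_integrable: "1 \<le> k \<Longrightarrow> integrable M (P k)"
  unfolding proj_diff_def using e_integrable by simp

lemma P_measurable_M [measurable]: "1 \<le> k \<Longrightarrow> P k \<in> borel_measurable M"
  using P_integrable by auto

lemma is_cond_expect_P:
  assumes k: "1 \<le> k"
  shows "is_cond_expect M (F (Suc k)) (P k) (\<lambda>_. 0)"
proof -
  interpret conditioning M "F (Suc k)"
    by (rule conditioning) simp
  have "P k = (\<lambda>\<omega>. e k \<omega> - e (Suc k) \<omega>)"
    by (simp add: proj_diff_def fun_eq_iff)
  then show ?thesis
    using is_cond_expect_diff[OF e_integrable[OF k] e_integrable is_cond_expect_e_Suc[OF k]
        is_cond_expect_self[OF e_measurable e_integrable]]
    by simp
qed

text \<open>In the induction step, s k e k = s k e (k+1) + s k P k, and s k + a (k+1) = s (k+1)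
  collects the coefficients of e (k+1).\<close>

lemma S_eq: "1 \<le> k \<Longrightarrow> S k \<omega> = s k *\<^sub>R e k \<omega> + (\<Sum>i=1..<k. s i *\<^sub>R P i \<omega>)"
proof (induction k rule: dec_induct)
  case (step k)
  then show ?case
    by (simp add: proj_diff_def algebra_simps)
qed simp

text \<open>The free term \<open>R\<close> cancels in the difference, so one identity serves both
  choices of \<open>R\<close>.\<close>

lemma S_eq_U:
  assumes k: "1 \<le> k" "k \<le> n"
  shows "S k \<omega> = s k *\<^sub>R e k \<omega> + U R 1 \<omega> - U R k \<omega>"
  unfolding S_eq[OF k(1)] U_def sum.atLeastLessThan_concat[OF k, symmetric] by simp

lemma U_Suc: "k < n \<Longrightarrow> U R k \<omega> = U R (Suc k) \<omega> + s k *\<^sub>R P k \<omega>"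
  by (simp add: U_def sum.atLeast_Suc_lessThan)

lemma e_Lp:
  assumes "1 < p" and k: "1 \<le> k"
  shows "(\<integral>\<^sup>+\<omega>. norm (e k \<omega>) powr p \<partial>M) < \<infinity>"
proof -
  interpret renorming "norm :: 'b \<Rightarrow> real"
    by (rule renorming_norm)
  interpret conditioning M "F k"
    by (rule conditioning[OF k])
  interpret conditioning_renorming M "F k" "norm :: 'b \<Rightarrow> real" ..
  show ?thesis
    using nn_integral_powr_cond_expect_le[OF assms(1) X_integrable is_cond_expect_e[OF k]] X_Lp
    by (rule le_less_trans)
qed

lemma P_Lp:
  assumes "1 < p" and k: "1 \<le> k"
  shows "(\<integral>\<^sup>+\<omega>. norm (s k *\<^sub>R P k \<omega>) powr p \<partial>M) < \<infinity>"
proof -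
  have "(\<integral>\<^sup>+\<omega>. norm (e k \<omega> + (-1) *\<^sub>R e (Suc k) \<omega>) powr p \<partial>M) < \<infinity>"
    using e_Lp[OF assms] e_Lp[OF assms(1), of "Suc k"] k
    by (intro nn_integral_powr_add_finite[OF assms(1)] nn_integral_powr_scaleR_finite) auto
  then show ?thesis
    using k by (intro nn_integral_powr_scaleR_finite) (auto simp: proj_diff_def)
qed

section \<open>The maximal estimate for an arbitrary terminal value\<close>

context
  fixes R :: "'a \<Rightarrow> 'b"
  assumes R: "R \<in> borel_measurable (F n)" "integrable M R"
begin

lemma U_integrable: "1 \<le> k \<Longrightarrow> integrable M (U R k)"
  unfolding U_def using R P_integrable by (auto intro!: Bochner_Integration.integrable_sum)

lemma U_measurable: "1 \<le> k \<Longrightarrow> k \<le> n \<Longrightarrow> U R k \<in> borel_measurable (F k)"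
  unfolding U_def
  using measurable_mono[OF _ _ R(1)] measurable_mono[OF _ _ P_measurable]
  by (intro borel_measurable_add borel_measurable_sum borel_measurable_scaleR) auto

text \<open>Of the two summands of \<open>U R k\<close> in \<open>U_Suc\<close>, the first is
  already \<open>F (Suc k)\<close>-measurable and the second is centred given
  \<open>F (Suc k)\<close>.\<close>

lemma is_cond_expect_U:
  assumes k: "1 \<le> k" "k < n"
  shows "is_cond_expect M (F (Suc k)) (U R k) (U R (Suc k))"
proof -
  interpret conditioning M "F (Suc k)"
    by (rule conditioning) simp
  have "is_cond_expect M (F (Suc k)) (\<lambda>\<omega>. U R (Suc k) \<omega> + s k *\<^sub>R P k \<omega>) (\<lambda>\<omega>. U R (Suc k) \<omega> + s k *\<^sub>R 0)"
    using k by (intro is_cond_expect_add is_cond_expect_self is_cond_expect_scaleR is_cond_expect_P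
        U_measurable U_integrable integrable_scaleR_right P_integrable) auto
  moreover have "U R k = (\<lambda>\<omega>. U R (Suc k) \<omega> + s k *\<^sub>R P k \<omega>)"
    using U_Suc[OF k(2)] by blast
  ultimately show ?thesis
    by simp
qed

text \<open>\<open>S_eq_U\<close> splits \<open>S k\<close> into three terms, at the price 3^(p-1).
  The first is the weighted projection, the second does not depend on \<open>k\<close>, and the
  maximum of the third is controlled by Doob's inequality.\<close>

lemma max_S_le:
  assumes p: "1 < p" and fin: "(\<integral>\<^sup>+\<omega>. norm (U R 1 \<omega>) powr p \<partial>M) < \<infinity>"
  shows "(\<integral>\<^sup>+\<omega>. (MAX k\<in>{1..n}. norm (S k \<omega>) powr p) \<partial>M)
    \<le> ennreal (3 powr (p - 1)) * ((\<integral>\<^sup>+\<omega>. (MAX k\<in>{1..n}. norm (s k *\<^sub>R e k \<omega>) powr p) \<partial>M)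
      + ennreal (2 * (p / (p - 1)) powr p) * (\<integral>\<^sup>+\<omega>. norm (U R 1 \<omega>) powr p \<partial>M))"
proof -
  define A where "A \<omega> = (MAX k\<in>{1..n}. norm (s k *\<^sub>R e k \<omega>) powr p)" for \<omega>
  define V where "V \<omega> = (MAX k\<in>{1..n}. norm (U R k \<omega>))" for \<omega>
  define q where "q = p / (p - 1)"
  have q: "1 \<le> q"
    using p by (simp add: q_def)
  let ?T = "\<integral>\<^sup>+\<omega>. norm (U R 1 \<omega>) powr p \<partial>M"
  have [measurable]: "U R k \<in> borel_measurable M" if "1 \<le> k" for k
    using U_integrable[OF that] by auto
  have [measurable]: "A \<in> borel_measurable M" "V \<in> borel_measurable M"
    unfolding A_def V_def by (intro borel_measurable_Max; simp)+
  have A0: "0 \<le> A \<omega>" for \<omega>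
  proof -
    have "norm (s 1 *\<^sub>R e 1 \<omega>) powr p \<le> A \<omega>"
      unfolding A_def using n_ge_1 by (intro Max_ge rev_image_eqI[of 1]) auto
    then show ?thesis
      using powr_ge_zero order_trans by blast
  qed
  have "(MAX k\<in>{1..n}. norm (S k \<omega>) powr p)
    \<le> 3 powr (p - 1) * (A \<omega> + norm (U R 1 \<omega>) powr p + V \<omega> powr p)" for \<omega>
  proof (rule Max.boundedI)
    fix r assume "r \<in> (\<lambda>k. norm (S k \<omega>) powr p) ` {1..n}"
    then obtain k where k: "1 \<le> k" "k \<le> n" and r: "r = norm (S k \<omega>) powr p"
      by auto
    have "norm (S k \<omega>) \<le> norm (s k *\<^sub>R e k \<omega>) + norm (U R 1 \<omega>) + norm (U R k \<omega>)"
      unfolding S_eq_U[OF k, of \<omega> R]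
      by (meson add_right_mono norm_triangle_ineq norm_triangle_ineq4 order_trans)
    then have "r \<le> (norm (s k *\<^sub>R e k \<omega>) + norm (U R 1 \<omega>) + norm (U R k \<omega>)) powr p"
      unfolding r using p by (intro powr_mono2) auto
    also have "\<dots> \<le> 3 powr (p - 1) *
      (norm (s k *\<^sub>R e k \<omega>) powr p + norm (U R 1 \<omega>) powr p + norm (U R k \<omega>) powr p)"
      using p by (intro powr_add3_le) auto
    also have "\<dots> \<le> 3 powr (p - 1) * (A \<omega> + norm (U R 1 \<omega>) powr p + V \<omega> powr p)"
      unfolding A_def V_def using k p
      by (intro mult_left_mono add_mono powr_mono2 order_refl Max_ge) auto
    finally show "r \<le> 3 powr (p - 1) * (A \<omega> + norm (U R 1 \<omega>) powr p + V \<omega> powr p)" .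
  qed (use n_ge_1 in auto)
  then have "(\<integral>\<^sup>+\<omega>. (MAX k\<in>{1..n}. norm (S k \<omega>) powr p) \<partial>M)
    \<le> (\<integral>\<^sup>+\<omega>. ennreal (3 powr (p - 1)) *
      (ennreal (A \<omega>) + ennreal (norm (U R 1 \<omega>) powr p) + ennreal (V \<omega> powr p)) \<partial>M)"
    using A0 by (intro nn_integral_mono) (simp add: ennreal_mult[symmetric] flip: ennreal_plus)
  also have "\<dots> = ennreal (3 powr (p - 1)) * ((\<integral>\<^sup>+\<omega>. A \<omega> \<partial>M) + (?T + (\<integral>\<^sup>+\<omega>. V \<omega> powr p \<partial>M)))"
    by (simp add: nn_integral_cmult nn_integral_add add.assoc)
  also have "(\<integral>\<^sup>+\<omega>. V \<omega> powr p \<partial>M) \<le> ennreal (q powr p) * ?T"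
    unfolding V_def q_def using n_ge_1
    by (intro reverse_doob_maximal[OF p] U_measurable U_integrable is_cond_expect_U fin) auto
  \<comment> \<open>Since q \<ge> 1, also 1 + q^p \<le> 2 q^p; this is the factor 2 of the
    statement.\<close>
  also have "?T + ennreal (q powr p) * ?T \<le> ennreal (2 * q powr p) * ?T"
  proof -
    have "1 \<le> q powr p"
      using q p by (simp add: ge_one_powr_ge_zero)
    then have "(ennreal 1 + ennreal (q powr p)) * ?T \<le> ennreal (2 * q powr p) * ?T"
      by (intro mult_right_mono) (simp_all flip: ennreal_plus del: ennreal_1)
    then show ?thesis
      by (simp add: distrib_right)
  qed
  finally show ?thesis
    unfolding A_def q_def by (simp add: add_left_mono mult_left_mono)
qed

end

section \<open>The two maximal inequalities\<close>

lemma max_S_le_part1: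
  assumes p: "1 < p"
  shows "(\<integral>\<^sup>+\<omega>. (MAX k\<in>{1..n}. norm (S k \<omega>) powr p) \<partial>M)
    \<le> ennreal (max_const p) * ((\<integral>\<^sup>+\<omega>. (MAX k\<in>{1..n}. norm (s k *\<^sub>R e k \<omega>) powr p) \<partial>M)
      + (\<integral>\<^sup>+\<omega>. norm (S n \<omega>) powr p \<partial>M))"
proof -
  define R where "R \<omega> = s n *\<^sub>R e n \<omega>" for \<omega>
  define q where "q = p / (p - 1)"
  have q: "1 \<le> q"
    using p by (simp add: q_def)
  have R: "R \<in> borel_measurable (F n)" "integrable M R"
    unfolding R_def using e_measurable[OF n_ge_1] e_integrable[OF n_ge_1] by auto
  have U1: "U R 1 = S n"
    using S_eq[OF n_ge_1] by (simp add: U_def R_def fun_eq_iff)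
  have fin: "(\<integral>\<^sup>+\<omega>. norm (S k \<omega>) powr p \<partial>M) < \<infinity>" for k
  proof (induction k)
    case (Suc k)
    have "(\<integral>\<^sup>+\<omega>. norm (S k \<omega> + a (Suc k) *\<^sub>R e (Suc k) \<omega>) powr p \<partial>M) < \<infinity>"
      using Suc e_Lp[OF p, of "Suc k"]
      by (intro nn_integral_powr_add_finite[OF p] nn_integral_powr_scaleR_finite) auto
    then show ?case
      by simp
  qed simp
  let ?A = "\<integral>\<^sup>+\<omega>. (MAX k\<in>{1..n}. norm (s k *\<^sub>R e k \<omega>) powr p) \<partial>M"
  let ?B = "\<integral>\<^sup>+\<omega>. norm (S n \<omega>) powr p \<partial>M"
  have q1: "1 \<le> q powr p"
    using q p by (simp add: ge_one_powr_ge_zero)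
  have "(\<integral>\<^sup>+\<omega>. (MAX k\<in>{1..n}. norm (S k \<omega>) powr p) \<partial>M)
    \<le> ennreal (3 powr (p - 1)) * (?A + ennreal (2 * q powr p) * ?B)"
    unfolding q_def using max_S_le[OF R p] fin unfolding U1 by blast
  \<comment> \<open>Both coefficients are raised to 3 q^p, because 3^(p-1) * 3 q^p = (3 q)^p is the
    announced constant.\<close>
  also have "\<dots> \<le> ennreal (3 powr (p - 1)) * (ennreal (3 * q powr p) * ?A + ennreal (3 * q powr p) * ?B)"
  proof (intro mult_left_mono add_mono)
    have "ennreal 1 * ?A \<le> ennreal (3 * q powr p) * ?A"
      using q1 by (intro mult_right_mono ennreal_leI) auto
    then show "?A \<le> ennreal (3 * q powr p) * ?A"
      by simp
    show "ennreal (2 * q powr p) * ?B \<le> ennreal (3 * q powr p) * ?B"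
      by (intro mult_right_mono ennreal_leI) auto
  qed auto
  also have "\<dots> = ennreal (3 powr (p - 1) * (3 * q powr p)) * (?A + ?B)"
    by (simp add: ennreal_mult distrib_left mult.assoc)
  also have "3 powr (p - 1) * (3 * q powr p) = max_const p"
    using q by (simp add: max_const_def q_def powr_mult powr_diff flip: times_divide_eq_right)
  finally show ?thesis .
qed

text \<open>For p > 1 the choice R = 0 makes \<open>U R 1\<close> a sum of martingale differences.
  Its moment is estimated in the smooth norm \<open>N\<close>: entering it is free because
  \<open>N\<close> dominates the given norm, and returning to the given norm costs K^p on each
  increment.\<close>

lemma max_S_le_part2:
  assumes p2: "p \<le> 2" and smooth: "r_smooth TYPE('b) p"
  shows "(\<integral>\<^sup>+\<omega>. (MAX k\<in>{1..n}. norm (S k \<omega>) powr p) \<partial>M)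
    \<le> ennreal (smooth_max_const TYPE('b) p) *
      ((\<integral>\<^sup>+\<omega>. (MAX k\<in>{1..n}. norm (s k *\<^sub>R e k \<omega>) powr p) \<partial>M)
      + (\<Sum>i=1..n-1. \<integral>\<^sup>+\<omega>. norm (s i *\<^sub>R P i \<omega>) powr p \<partial>M))"
proof (cases "p = 1")
  case True
  have "(MAX k\<in>{1..n}. norm (S k \<omega>) powr p)
    \<le> (MAX k\<in>{1..n}. norm (s k *\<^sub>R e k \<omega>) powr p) + (\<Sum>i=1..n-1. norm (s i *\<^sub>R P i \<omega>) powr p)" for \<omega>
  proof (rule Max.boundedI)
    fix r assume "r \<in> (\<lambda>k. norm (S k \<omega>) powr p) ` {1..n}"
    then obtain k where k: "1 \<le> k" "k \<le> n" and r: "r = norm (S k \<omega>)"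
      using True by auto
    have "r \<le> norm (s k *\<^sub>R e k \<omega>) + (\<Sum>i=1..<k. norm (s i *\<^sub>R P i \<omega>))"
      unfolding r S_eq[OF k(1)] by (intro order_trans[OF norm_triangle_ineq] add_mono norm_sum order_refl)
    also have "\<dots> \<le> (MAX k\<in>{1..n}. norm (s k *\<^sub>R e k \<omega>)) + (\<Sum>i=1..n-1. norm (s i *\<^sub>R P i \<omega>))"
      using k by (intro add_mono Max_ge sum_mono2) auto
    finally show "r \<le> (MAX k\<in>{1..n}. norm (s k *\<^sub>R e k \<omega>) powr p) + (\<Sum>i=1..n-1. norm (s i *\<^sub>R P i \<omega>) powr p)"
      using True by simp
  qed (use n_ge_1 in auto)
  then have "(\<integral>\<^sup>+\<omega>. (MAX k\<in>{1..n}. norm (S k \<omega>) powr p) \<partial>M)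
    \<le> (\<integral>\<^sup>+\<omega>. ennreal (MAX k\<in>{1..n}. norm (s k *\<^sub>R e k \<omega>) powr p)
      + (\<Sum>i=1..n-1. ennreal (norm (s i *\<^sub>R P i \<omega>) powr p)) \<partial>M)"
    using n_ge_1
    by (intro nn_integral_mono) (subst sum_ennreal, simp, subst ennreal_plus[symmetric],
      auto simp: Max_ge_iff sum_nonneg ennreal_leI)
  also have "\<dots> = (\<integral>\<^sup>+\<omega>. (MAX k\<in>{1..n}. norm (s k *\<^sub>R e k \<omega>) powr p) \<partial>M)
      + (\<Sum>i=1..n-1. \<integral>\<^sup>+\<omega>. norm (s i *\<^sub>R P i \<omega>) powr p \<partial>M)"
  proof -
    have *: "(\<lambda>\<omega>. MAX k\<in>{1..n}. norm (s k *\<^sub>R e k \<omega>) powr p) \<in> borel_measurable M"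
      by (intro borel_measurable_Max) simp_all
    have **: "(\<lambda>\<omega>. ennreal (norm (s i *\<^sub>R P i \<omega>) powr p)) \<in> borel_measurable M" if "i \<in> {1..n-1}" for i
      using that by auto
    have "(\<Sum>i=1..n-1. \<integral>\<^sup>+\<omega>. norm (s i *\<^sub>R P i \<omega>) powr p \<partial>M)
      = (\<integral>\<^sup>+\<omega>. (\<Sum>i=1..n-1. ennreal (norm (s i *\<^sub>R P i \<omega>) powr p)) \<partial>M)"
      by (rule nn_integral_sum[OF **, symmetric])
    then show ?thesis
      using nn_integral_add[OF measurable_compose[OF * measurable_ennreal] borel_measurable_sum[OF **]]
      by (simp only:)
  qed
  finally show ?thesis
    using True by (simp add: smooth_max_const_def)
next
  case False
  then have p: "1 < p"
    using p_ge_1 by simp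
  define K where "K = smoothness_const TYPE('b) p"
  have K1: "1 \<le> K"
    unfolding K_def using smoothness_const[OF smooth] by (rule conjunct1)
  obtain N :: "'b \<Rightarrow> real" where N: "equivalent_norm N"
    and N_bounds: "\<forall>x. norm x \<le> N x \<and> N x \<le> K * norm x"
    and modulus: "\<forall>\<tau>>0. modulus_of_smoothness N \<tau> \<le> ereal (K * \<tau> powr p)"
    unfolding K_def using smoothness_const[OF smooth] by blast
  have N_ge: "norm x \<le> N x" and N_le: "N x \<le> K * norm x" for x
    using N_bounds by auto
  interpret renorming N
    by unfold_locales (rule N)
  let ?c = "4 * K + 8"
  let ?Q = "\<lambda>i. \<integral>\<^sup>+\<omega>. N (s i *\<^sub>R P i \<omega>) powr p \<partial>M"
  let ?Y = "\<lambda>i. \<integral>\<^sup>+\<omega>. norm (s i *\<^sub>R P i \<omega>) powr p \<partial>M"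
  have Q_le: "?Q i \<le> ennreal (K powr p) * ?Y i" if "1 \<le> i" for i
  proof -
    have "?Q i \<le> (\<integral>\<^sup>+\<omega>. ennreal (K powr p) * ennreal (norm (s i *\<^sub>R P i \<omega>) powr p) \<partial>M)"
    proof (rule nn_integral_mono)
      fix \<omega>
      have "N (s i *\<^sub>R P i \<omega>) powr p \<le> (K * norm (s i *\<^sub>R P i \<omega>)) powr p"
        using p N_le by (intro powr_mono2) (simp_all del: norm_scaleR)
      then show "ennreal (N (s i *\<^sub>R P i \<omega>) powr p)
        \<le> ennreal (K powr p) * ennreal (norm (s i *\<^sub>R P i \<omega>) powr p)"
        using K1 by (simp add: powr_mult ennreal_mult[symmetric] del: norm_scaleR)
    qed
    also have "\<dots> = ennreal (K powr p) * ?Y i"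
      using that by (intro nn_integral_cmult) auto
    finally show ?thesis .
  qed
  have Q_fin: "?Q i < \<infinity>" if "1 \<le> i" for i
    using le_less_trans[OF Q_le[OF that]] P_Lp[OF p that] by (simp add: ennreal_mult_less_top)
  have zero: "(\<lambda>_. 0) \<in> borel_measurable (F n)" "integrable M (\<lambda>_. 0 :: 'b)"
    by auto
  \<comment> \<open>Downward induction from \<open>k = n\<close>, where the sum is empty. Passing
    from \<open>Suc k\<close> to \<open>k\<close> adds s k P k, centred given
    \<open>F (Suc k)\<close>, to an \<open>F (Suc k)\<close>-measurable sum; the bound already
    obtained supplies the finiteness for the cancellation.\<close>
  have assouad: "(\<integral>\<^sup>+\<omega>. N (U (\<lambda>_. 0) k \<omega>) powr p \<partial>M) \<le> ennreal ?c * (\<Sum>i=k..<n. ?Q i)"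
    if "1 \<le> k" "k \<le> n" for k
    using that(2,1)
  proof (induction rule: inc_induct)
    case base
    then show ?case
      by (simp add: U_def)
  next
    case (step k)
    interpret conditioning M "F (Suc k)"
      by (rule conditioning) simp
    interpret conditioning_renorming M "F (Suc k)" N ..
    have IH: "(\<integral>\<^sup>+\<omega>. N (U (\<lambda>_. 0) (Suc k) \<omega>) powr p \<partial>M) \<le> ennreal ?c * (\<Sum>i=Suc k..<n. ?Q i)"
      using step by simp
    also have "\<dots> < \<infinity>"
      using Q_fin by (auto simp: ennreal_mult_less_top)
    finally have fin: "(\<integral>\<^sup>+\<omega>. N (U (\<lambda>_. 0) (Suc k) \<omega>) powr p \<partial>M) < \<infinity>" .
    have "(\<integral>\<^sup>+\<omega>. N (U (\<lambda>_. 0) k \<omega>) powr p \<partial>M)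
      = (\<integral>\<^sup>+\<omega>. N (U (\<lambda>_. 0) (Suc k) \<omega> + s k *\<^sub>R P k \<omega>) powr p \<partial>M)"
      by (simp only: U_Suc[OF step(2)])
    also have "\<dots> \<le> (\<integral>\<^sup>+\<omega>. N (U (\<lambda>_. 0) (Suc k) \<omega>) powr p \<partial>M) + ennreal ?c * ?Q k"
    proof (rule nn_integral_powr_add_martingale_diff_le[OF p])
      show "N (x + y) powr p + N (x - y) powr p \<le> 2 * N x powr p + ?c * N y powr p" for x y
        using p p2 K1 modulus by (intro smooth_powr_le) auto
      show "is_cond_expect M (F (Suc k)) (\<lambda>\<omega>. s k *\<^sub>R P k \<omega>) (\<lambda>_. 0)"
        using is_cond_expect_scaleR[OF is_cond_expect_P[of k], of "s k"] step by simp
    qed (use K1 step fin U_measurable[OF zero] U_integrable[OF zero] P_integrable in auto)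
    also have "\<dots> \<le> ennreal ?c * (\<Sum>i=Suc k..<n. ?Q i) + ennreal ?c * ?Q k"
      by (intro add_right_mono IH)
    also have "\<dots> = ennreal ?c * (\<Sum>i=k..<n. ?Q i)"
      using step by (simp add: sum.atLeast_Suc_lessThan distrib_left add.commute)
    finally show ?case .
  qed
  let ?A = "\<integral>\<^sup>+\<omega>. (MAX k\<in>{1..n}. norm (s k *\<^sub>R e k \<omega>) powr p) \<partial>M"
  let ?T = "\<integral>\<^sup>+\<omega>. norm (U (\<lambda>_. 0) 1 \<omega>) powr p \<partial>M"
  let ?B = "\<Sum>i=1..n-1. ?Y i"
  have "?T \<le> (\<integral>\<^sup>+\<omega>. N (U (\<lambda>_. 0) 1 \<omega>) powr p \<partial>M)"
    using p N_ge by (intro nn_integral_mono ennreal_leI powr_mono2) auto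
  also have "\<dots> \<le> ennreal ?c * (\<Sum>i=1..<n. ?Q i)"
    using n_ge_1 by (intro assouad) auto
  also have "\<dots> \<le> ennreal ?c * (\<Sum>i=1..<n. ennreal (K powr p) * ?Y i)"
    by (intro mult_left_mono sum_mono Q_le) auto
  also have "\<dots> = ennreal (?c * K powr p) * (\<Sum>i=1..<n. ?Y i)"
    using K1 by (simp add: ennreal_mult sum_distrib_left mult.assoc)
  also have "{1..<n} = {1..n-1}"
    using n_ge_1 by auto
  also have "ennreal (?c * K powr p) * ?B \<le> ennreal (12 * K ^ 3) * ?B"
  proof (intro mult_right_mono ennreal_leI)
    \<comment> \<open>From K \<ge> 1 and p \<le> 2: 4 K + 8 \<le> 12 K and K^p \<le> K^2.\<close>
    have "?c * K powr p \<le> (12 * K) * K powr 2"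
      using K1 p2 by (intro mult_mono powr_mono) auto
    then show "?c * K powr p \<le> 12 * K ^ 3"
      using K1 by (simp add: power3_eq_cube power2_eq_square)
  qed auto
  finally have T_le: "?T \<le> ennreal (12 * K ^ 3) * ?B" .
  have "?B < \<infinity>"
    using P_Lp[OF p] by auto
  then have fin: "?T < \<infinity>"
    using le_less_trans[OF T_le] by (simp add: ennreal_mult_less_top)
  define q where "q = p / (p - 1)"
  have q: "1 \<le> q"
    using p by (simp add: q_def)
  have q1: "1 \<le> q powr p"
    using q p by (simp add: ge_one_powr_ge_zero)
  have K3: "1 \<le> K ^ 3"
    using K1 by (rule one_le_power)
  have Kq: "1 \<le> K ^ 3 * q powr p"
    using mult_mono[OF K3 q1] K1 by simp
  have "(\<integral>\<^sup>+\<omega>. (MAX k\<in>{1..n}. norm (S k \<omega>) powr p) \<partial>M)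
    \<le> ennreal (3 powr (p - 1)) * (?A + ennreal (2 * q powr p) * ?T)"
    unfolding q_def by (rule max_S_le[OF zero p fin])
  \<comment> \<open>As p \<le> 2, 3^(p-1) \<le> 3. The coefficient 2 * 12 = 24 of \<open>?B\<close>
    is rounded up to 32, which together with the 3 gives the 96 of
    \<open>smooth_max_const\<close>.\<close>
  also have "\<dots> \<le> ennreal 3 * (ennreal (32 * (K ^ 3 * q powr p)) * ?A + ennreal (32 * (K ^ 3 * q powr p)) * ?B)"
  proof (rule mult_mono[OF _ add_mono])
    show "ennreal (3 powr (p - 1)) \<le> ennreal 3"
      using powr_mono[of "p - 1" 1 3] p2 by (intro ennreal_leI) simp
    have "ennreal 1 * ?A \<le> ennreal (32 * (K ^ 3 * q powr p)) * ?A"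
      using Kq by (intro mult_right_mono ennreal_leI) auto
    then show "?A \<le> ennreal (32 * (K ^ 3 * q powr p)) * ?A"
      by simp
    have "ennreal (2 * q powr p) * ?T \<le> ennreal (2 * q powr p) * (ennreal (12 * K ^ 3) * ?B)"
      by (intro mult_left_mono T_le) auto
    also have "\<dots> = ennreal (24 * (K ^ 3 * q powr p)) * ?B"
      using K1 by (simp add: ennreal_mult[symmetric] mult.assoc[symmetric]) (simp add: mult_ac)
    also have "\<dots> \<le> ennreal (32 * (K ^ 3 * q powr p)) * ?B"
      using Kq by (intro mult_right_mono ennreal_leI) auto
    finally show "ennreal (2 * q powr p) * ?T \<le> ennreal (32 * (K ^ 3 * q powr p)) * ?B" .
  qed auto
  also have "\<dots> = ennreal (3 * (32 * (K ^ 3 * q powr p))) * (?A + ?B)"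
    using Kq by (subst ennreal_mult) (auto simp: distrib_left mult.assoc)
  also have "3 * (32 * (K ^ 3 * q powr p)) = smooth_max_const TYPE('b) p"
    using False by (simp add: smooth_max_const_def K_def q_def)
  finally show ?thesis .
qed

end

theorem corollary3:
  fixes M :: "'a measure"
    and F :: "nat \<Rightarrow> 'a measure"
    and a :: "nat \<Rightarrow> real"
    and X :: "'a \<Rightarrow> 'b::{banach, second_countable_topology}"
    and p :: real
    and n :: nat
  assumes "prob_space M"
    and "decreasing_subfields M F"
    and "\<not> summable (\<lambda>j. \<bar>a (Suc j)\<bar>)"
    and "X \<in> borel_measurable M"
    and "(\<integral>\<^sup>+\<omega>. ennreal (norm (X \<omega>) powr p) \<partial>M) < \<infinity>"
    and "1 \<le> n"
  shows
    "(1 < p \<longrightarrow>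
        (\<integral>\<^sup>+\<omega>. ennreal (MAX k\<in>{1..n}. norm (\<Sum>j=1..k. a j *\<^sub>R cond_expect M (F j) X \<omega>) powr p) \<partial>M)
        \<le> ennreal (max_const p) *
          ((\<integral>\<^sup>+\<omega>. ennreal (MAX k\<in>{1..n}. norm ((\<Sum>i=1..k. a i) *\<^sub>R cond_expect M (F k) X \<omega>) powr p) \<partial>M)
           + (\<integral>\<^sup>+\<omega>. ennreal (norm (\<Sum>j=1..n. a j *\<^sub>R cond_expect M (F j) X \<omega>) powr p) \<partial>M)))
     \<and>
     (1 \<le> p \<and> p \<le> 2 \<and> r_smooth TYPE('b) p \<longrightarrow>
        (\<integral>\<^sup>+\<omega>. ennreal (MAX k\<in>{1..n}. norm (\<Sum>j=1..k. a j *\<^sub>R cond_expect M (F j) X \<omega>) powr p) \<partial>M)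
        \<le> ennreal (smooth_max_const TYPE('b) p) *
          ((\<integral>\<^sup>+\<omega>. ennreal (MAX k\<in>{1..n}. norm ((\<Sum>i=1..k. a i) *\<^sub>R cond_expect M (F k) X \<omega>) powr p) \<partial>M)
           + (\<Sum>i=1..n-1. \<integral>\<^sup>+\<omega>. ennreal (norm ((\<Sum>j=1..i. a j) *\<^sub>R proj_diff M F i X \<omega>) powr p) \<partial>M)))"
proof -
  have "weighted_projections M F X p n" if "1 \<le> p"
    using assms that by (auto simp: weighted_projections_def weighted_projections_axioms_def
        reverse_filtration_def reverse_filtration_axioms_def)
  then show ?thesis
    by (intro conjI impI)
      (auto intro!: weighted_projections.max_S_le_part1 weighted_projections.max_S_le_part2
        simp del: norm_scaleR One_nat_def)
qed

end
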